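(* Let $X,Y$ be symplectic manifolds with compatible almost complex structures, and let $M=(M,\omega_M,J_M,p_0,p_1)$ be a connected symplectic manifold with compatible almost complex structure and two marked points. Assume that there exists a pseudoholomorphic map $\gamma:M\to M$ with $\gamma(p_0)=p_1$ and $\gamma(p_1)=p_0$. Then the $M$-homotopy relation is an equivalence relation on $JC(Y,X)$.
   Context: All manifolds are smooth without boundary; products carry product structures. A smooth map $f:Y\to X$ is pseudoholomorphic if $df\circ J_Y=J_X\circ df$. Pseudoholomorphic correspondences: for $n\ge 1$, $JCor_n(Y,X)$ is the set of global sections over $Y$ of the sheafification of the presheaf sending an open $U\subset Y$ to the set of unordered $n$-tuples $\{f_1,\dots,f_n\}$ of pseudoholomorphic maps $U\to X$, two tuples being identified if $\{f_i(y)\}_i=\{g_i(y)\}_i$ as unordered tuples with multiplicity for every $y\in U$. $JCor_0(Y,X)$ consists of one element, the empty correspondence $\emptyset$. $JCor(Y,X)$ is the set of global sections over $Y$ of the sheafification of $U\mapsto\coprod_{n\ge 0}JCor_n(U,X)$. Addition is local concatenation of tuples, making $JCor(Y,X)$ a commutative monoid with zero $\emptyset$; $JC(Y,X)$ is its Grothendieck group. For a pseudoholomorphic map $h:Y\to Y'$ and $H\in JC(Y',X)$, $H\circ h\in JC(Y,X)$ is the image of $H$ under the homomorphism locally given by $\{f_i\}\mapsto\{f_i\circ h\}$. $M$-homotopy: $F,G\in JC(Y,X)$ are $M$-homotopic if there is $H\in JC(Y\times M,X)$ with $H\circ i_0=F$ and $H\circ i_1=G$, where $i_\varepsilon:Y=Y\times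 p_\varepsilon\hookrightarrow Y\times M$. *)

theory Defs
  imports "HOL-Analysis.Analysis" "HOL-Algebra.Group" "HOL-Library.Multiset"
begin

section \<open>Smooth manifolds\<close>

primrec Ck_on :: "nat \<Rightarrow> 'a::real_normed_vector set \<Rightarrow> ('a \<Rightarrow> 'b::real_normed_vector) \<Rightarrow> bool" where
  "Ck_on 0 S f \<longleftrightarrow> continuous_on S f"
| "Ck_on (Suc k) S f \<longleftrightarrow>
     (\<forall>x\<in>S. f differentiable at x) \<and> (\<forall>v. Ck_on k S (\<lambda>x. frechet_derivative f (at x) v))"

text \<open>Only used for open subsets \<open>S\<close> of finite-dimensional spaces.\<close>

definition smooth_on :: "'a::real_normed_vector set \<Rightarrow> ('a \<Rightarrow> 'b::real_normed_vector) \<Rightarrow> bool" where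
  "smooth_on S f \<longleftrightarrow> (\<forall>k. Ck_on k S f)"

text \<open>
  A manifold is a topology with an atlas indexed by \<open>idx\<close>; the chart \<open>i\<close> is \<open>chart i\<close>, with domain
  \<open>cdom i\<close>.  Charts take values in a finite-dimensional normed space.  The class \<open>euclidean_space\<close>
  is avoided because it excludes manifolds of dimension 0.  Atlases need not be maximal.
\<close>

record ('a, 'i, 'e) manifold =
  mtop :: "'a topology"
  idx :: "'i set"
  cdom :: "'i \<Rightarrow> 'a set"
  chart :: "'i \<Rightarrow> 'a \<Rightarrow> 'e"

definition param :: "('a, 'i, 'e, 'z) manifold_scheme \<Rightarrow> 'i \<Rightarrow> 'e \<Rightarrow> 'a" where
  "param X i = inv_into (cdom X i) (chart X i)"

definition local_rep ::
  "('a, 'i, 'e, 'z) manifold_scheme \<Rightarrow> ('b, 'j, 'f, 'w) manifold_scheme \<Rightarrow> ('a \<Rightarrow> 'b) \<Rightarrow> 'i \<Rightarrow> 'j \<Rightarrow> 'e \<Rightarrow> 'f"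
  where "local_rep Y X f i j = chart X j \<circ> f \<circ> param Y i"

abbreviation transition :: "('a, 'i, 'e, 'z) manifold_scheme \<Rightarrow> 'i \<Rightarrow> 'i \<Rightarrow> 'e \<Rightarrow> 'e" where
  "transition X \<equiv> local_rep X X (\<lambda>a. a)"

definition smooth_manifold :: "('a, 'i, 'e::real_normed_vector, 'z) manifold_scheme \<Rightarrow> bool" where
  "smooth_manifold X \<longleftrightarrow>
     (\<exists>B::'e set. finite B \<and> span B = UNIV) \<and>
     Hausdorff_space (mtop X) \<and> second_countable (mtop X) \<and>
     topspace (mtop X) = (\<Union>i\<in>idx X. cdom X i) \<and>
     (\<forall>i\<in>idx X. openin (mtop X) (cdom X i) \<and> open (chart X i ` cdom X i) \<and>
        homeomorphic_map (subtopology (mtop X) (cdom X i)) (top_of_set (chart X i ` cdom X i)) (chart X i)) \<and>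
     (\<forall>i\<in>idx X. \<forall>j\<in>idx X. smooth_on (chart X i ` (cdom X i \<inter> cdom X j)) (transition X i j))"

definition smooth_map ::
  "('a, 'i, 'e::real_normed_vector, 'z) manifold_scheme \<Rightarrow>
   ('b, 'j, 'f::real_normed_vector, 'w) manifold_scheme \<Rightarrow> ('a \<Rightarrow> 'b) \<Rightarrow> bool" where
  "smooth_map Y X f \<longleftrightarrow>
     continuous_map (mtop Y) (mtop X) f \<and>
     (\<forall>i\<in>idx Y. \<forall>j\<in>idx X.
        smooth_on (chart Y i ` {y \<in> cdom Y i. f y \<in> cdom X j}) (local_rep Y X f i j))"


section \<open>Symplectic manifolds with compatible almost complex structures\<close>

text \<open>
  Tensor fields are given by their components in each chart: \<open>omega i x u v\<close> is the value of the
  2-form on the tangent vectors with coordinates \<open>u\<close>, \<open>v\<close> in the chart \<open>i\<close>, at the point whose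
  coordinate in that chart is \<open>x\<close>; \<open>acs i x u\<close> is the coordinate vector of \<open>J u\<close>.  The components
  in different charts are related by the derivatives of the transition maps.
\<close>

record ('a, 'i, 'e) ac_manifold = "('a, 'i, 'e) manifold" +
  omega :: "'i \<Rightarrow> 'e \<Rightarrow> 'e \<Rightarrow> 'e \<Rightarrow> real"
  acs :: "'i \<Rightarrow> 'e \<Rightarrow> 'e \<Rightarrow> 'e"

definition symplectic_form :: "('a, 'i, 'e::real_normed_vector) ac_manifold \<Rightarrow> bool" where
  "symplectic_form X \<longleftrightarrow>
     (\<forall>i\<in>idx X. \<forall>x\<in>chart X i ` cdom X i.
        bilinear (omega X i x) \<and> (\<forall>v. omega X i x v v = 0) \<and>
        (\<forall>v. (\<forall>w. omega X i x v w = 0) \<longrightarrow> v = 0)) \<and>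
     (\<forall>i\<in>idx X. \<forall>v w. smooth_on (chart X i ` cdom X i) (\<lambda>x. omega X i x v w)) \<and>
     (\<forall>i\<in>idx X. \<forall>j\<in>idx X. \<forall>x\<in>chart X i ` (cdom X i \<inter> cdom X j).
        let D = frechet_derivative (transition X i j) (at x) in
        \<forall>v w. omega X j (transition X i j x) (D v) (D w) = omega X i x v w) \<and>
     \<comment> \<open>closedness: the exterior derivative on constant coordinate fields \<open>u\<close>, \<open>v\<close>, \<open>w\<close>\<close>
     (\<forall>i\<in>idx X. \<forall>x\<in>chart X i ` cdom X i. \<forall>u v w.
        frechet_derivative (\<lambda>z. omega X i z v w) (at x) u
        + frechet_derivative (\<lambda>z. omega X i z w u) (at x) v
        + frechet_derivative (\<lambda>z. omega X i z u v) (at x) w = 0)"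

definition almost_complex_structure :: "('a, 'i, 'e::real_normed_vector) ac_manifold \<Rightarrow> bool" where
  "almost_complex_structure X \<longleftrightarrow>
     (\<forall>i\<in>idx X. \<forall>x\<in>chart X i ` cdom X i.
        linear (acs X i x) \<and> (\<forall>v. acs X i x (acs X i x v) = - v)) \<and>
     (\<forall>i\<in>idx X. \<forall>v. smooth_on (chart X i ` cdom X i) (\<lambda>x. acs X i x v)) \<and>
     (\<forall>i\<in>idx X. \<forall>j\<in>idx X. \<forall>x\<in>chart X i ` (cdom X i \<inter> cdom X j).
        let D = frechet_derivative (transition X i j) (at x) in
        \<forall>v. D (acs X i x v) = acs X j (transition X i j x) (D v))"

definition compatible :: "('a, 'i, 'e::real_normed_vector) ac_manifold \<Rightarrow> bool" where
  "compatible X \<longleftrightarrow>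
     (\<forall>i\<in>idx X. \<forall>x\<in>chart X i ` cdom X i.
        (\<forall>v w. omega X i x (acs X i x v) (acs X i x w) = omega X i x v w) \<and>
        (\<forall>v. v \<noteq> 0 \<longrightarrow> omega X i x v (acs X i x v) > 0))"

definition symplectic_ac_manifold :: "('a, 'i, 'e::real_normed_vector) ac_manifold \<Rightarrow> bool" where
  "symplectic_ac_manifold X \<longleftrightarrow>
     smooth_manifold X \<and> symplectic_form X \<and> almost_complex_structure X \<and> compatible X"

definition open_submanifold :: "('a, 'i, 'e) ac_manifold \<Rightarrow> 'a set \<Rightarrow> ('a, 'i, 'e) ac_manifold" where
  "open_submanifold Y U = Y\<lparr>mtop := subtopology (mtop Y) U, cdom := (\<lambda>i. cdom Y i \<inter> U)\<rparr>"

definition prod_manifold ::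
  "('a, 'i, 'e) ac_manifold \<Rightarrow> ('b, 'j, 'f) ac_manifold \<Rightarrow> ('a \<times> 'b, 'i \<times> 'j, 'e \<times> 'f) ac_manifold" where
  "prod_manifold Y M =
     \<lparr>mtop = prod_topology (mtop Y) (mtop M),
      idx = idx Y \<times> idx M,
      cdom = (\<lambda>(i, j). cdom Y i \<times> cdom M j),
      chart = (\<lambda>(i, j). map_prod (chart Y i) (chart M j)),
      omega = (\<lambda>(i, j) (x, z) (u, v) (u', v'). omega Y i x u u' + omega M j z v v'),
      acs = (\<lambda>(i, j) (x, z) (u, v). (acs Y i x u, acs M j z v))\<rparr>"

definition pseudoholomorphic ::
  "('a, 'i, 'e::real_normed_vector) ac_manifold \<Rightarrow> ('b, 'j, 'f::real_normed_vector) ac_manifold \<Rightarrow>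
   ('a \<Rightarrow> 'b) \<Rightarrow> bool" where
  "pseudoholomorphic Y X f \<longleftrightarrow>
     smooth_map Y X f \<and>
     (\<forall>i\<in>idx Y. \<forall>j\<in>idx X. \<forall>y\<in>cdom Y i. f y \<in> cdom X j \<longrightarrow>
        (let D = frechet_derivative (local_rep Y X f i j) (at (chart Y i y)) in
         \<forall>v. D (acs Y i (chart Y i y) v) = acs X j (chart X j (f y)) (D v)))"


section \<open>Presheaves of sets and sheafification\<close>

text \<open>\<open>res P U V\<close> is the restriction of sections from \<open>U\<close> to \<open>V \<subseteq> U\<close>.\<close>

record ('a, 's) presheaf =
  sect :: "'a set \<Rightarrow> 's set"
  res :: "'a set \<Rightarrow> 'a set \<Rightarrow> 's \<Rightarrow> 's"

definition germ :: "'a topology \<Rightarrow> ('a, 's) presheaf \<Rightarrow> 'a \<Rightarrow> 'a set \<Rightarrow> 's \<Rightarrow> ('a set \<times> 's) set" where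
  "germ T P x U s =
     {(V, t). openin T V \<and> x \<in> V \<and> t \<in> sect P V \<and>
              (\<exists>W. openin T W \<and> x \<in> W \<and> W \<subseteq> U \<inter> V \<and> res P U W s = res P V W t)}"

text \<open>
  Sections of the sheafification over an open set \<open>U\<close> are the maps from \<open>U\<close> to germs that are
  locally induced by sections of the presheaf (continuous sections of the etale space).
\<close>

type_synonym ('a, 's) germs = "'a \<Rightarrow> ('a set \<times> 's) set"

definition sheafify :: "'a topology \<Rightarrow> ('a, 's) presheaf \<Rightarrow> ('a, ('a, 's) germs) presheaf" where
  "sheafify T P =
     \<lparr>sect = (\<lambda>U. {\<sigma> \<in> extensional U.
                 \<forall>x\<in>U. \<exists>V s. openin T V \<and> x \<in> V \<and> V \<subseteq> U \<and> s \<in> sect P V \<and>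
                         (\<forall>y\<in>V. \<sigma> y = germ T P y V s)}),
      res = (\<lambda>U V \<sigma>. restrict \<sigma> V)\<rparr>"

text \<open>
  The map on sections of sheafifications over \<open>U\<close> induced by an operation \<open>b V\<close>, natural in the
  open set \<open>V\<close>, that sends a section of \<open>P\<close> and a section of \<open>Q\<close> over \<open>V\<close> to a section of \<open>R\<close> over \<open>V\<close>.
\<close>

definition sheafify_map2 ::
  "'a topology \<Rightarrow> ('a, 's) presheaf \<Rightarrow> ('a, 't) presheaf \<Rightarrow> ('a, 'r) presheaf \<Rightarrow>
   ('a set \<Rightarrow> 's \<Rightarrow> 't \<Rightarrow> 'r) \<Rightarrow> 'a set \<Rightarrow> ('a, 's) germs \<Rightarrow> ('a, 't) germs \<Rightarrow> ('a, 'r) germs" where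
  "sheafify_map2 T P Q R b U \<sigma> \<tau> =
     (\<lambda>x\<in>U. THE g. \<exists>V s t. openin T V \<and> x \<in> V \<and> V \<subseteq> U \<and> s \<in> sect P V \<and> t \<in> sect Q V \<and>
                     \<sigma> x = germ T P x V s \<and> \<tau> x = germ T Q x V t \<and> g = germ T R x V (b V s t))"

abbreviation preim :: "'a topology \<Rightarrow> ('a \<Rightarrow> 'b) \<Rightarrow> 'b set \<Rightarrow> 'a set" where
  "preim T h V \<equiv> {x \<in> topspace T. h x \<in> V}"

text \<open>
  Likewise for a continuous map \<open>h\<close> from \<open>T\<close> to \<open>T'\<close> and natural maps \<open>c V\<close> from the sections over
  \<open>V\<close> of a presheaf \<open>P\<close> on \<open>T'\<close> to the sections over \<open>preim T h V\<close> of a presheaf \<open>Q\<close> on \<open>T\<close>.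
\<close>

definition sheafify_pullback ::
  "'a topology \<Rightarrow> 'b topology \<Rightarrow> ('a \<Rightarrow> 'b) \<Rightarrow> ('b, 's) presheaf \<Rightarrow> ('a, 'r) presheaf \<Rightarrow>
   ('b set \<Rightarrow> 's \<Rightarrow> 'r) \<Rightarrow> 'b set \<Rightarrow> ('b, 's) germs \<Rightarrow> ('a, 'r) germs" where
  "sheafify_pullback T T' h P Q c U \<sigma> =
     (\<lambda>x\<in>preim T h U. THE g. \<exists>V s. openin T' V \<and> h x \<in> V \<and> V \<subseteq> U \<and> s \<in> sect P V \<and>
                     \<sigma> (h x) = germ T' P (h x) V s \<and> g = germ T Q x (preim T h V) (c V s))"


section \<open>Pseudoholomorphic correspondences\<close>

definition tuples ::
  "('y, 'i, 'e::real_normed_vector) ac_manifold \<Rightarrow> ('x, 'j, 'f::real_normed_vector) ac_manifold \<Rightarrow>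
   nat \<Rightarrow> 'y set \<Rightarrow> ('y \<Rightarrow> 'x) multiset set" where
  "tuples Y X n U =
     {A. size A = n \<and>
         (\<forall>f\<in>#A. f \<in> extensional U \<and> pseudoholomorphic (open_submanifold Y U) X f)}"

definition tuple_rel ::
  "('y, 'i, 'e::real_normed_vector) ac_manifold \<Rightarrow> ('x, 'j, 'f::real_normed_vector) ac_manifold \<Rightarrow>
   nat \<Rightarrow> 'y set \<Rightarrow> (('y \<Rightarrow> 'x) multiset \<times> ('y \<Rightarrow> 'x) multiset) set" where
  "tuple_rel Y X n U =
     {(A, B). A \<in> tuples Y X n U \<and> B \<in> tuples Y X n U \<and>
              (\<forall>y\<in>U. image_mset (\<lambda>f. f y) A = image_mset (\<lambda>f. f y) B)}"

type_synonym ('y, 'x) tuple_class = "('y \<Rightarrow> 'x) multiset set"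

definition tuple_presheaf ::
  "('y, 'i, 'e::real_normed_vector) ac_manifold \<Rightarrow> ('x, 'j, 'f::real_normed_vector) ac_manifold \<Rightarrow>
   nat \<Rightarrow> ('y, ('y, 'x) tuple_class) presheaf" where
  "tuple_presheaf Y X n =
     \<lparr>sect = (\<lambda>U. tuples Y X n U // tuple_rel Y X n U),
      res = (\<lambda>U V c. \<Union>A\<in>c. tuple_rel Y X n V `` {image_mset (\<lambda>f. restrict f V) A})\<rparr>"

text \<open>
  For open \<open>U \<subseteq> Y\<close>, \<open>JCor\<^sub>n(U, X)\<close> is the set of sections over \<open>U\<close> of the sheafification on \<open>Y\<close>.
  For \<open>n = 0\<close> the same formula gives a one-element set, see \<open>jcor_n_0\<close> below.
\<close>

definition jcor_n_sheaf ::
  "('y, 'i, 'e::real_normed_vector) ac_manifold \<Rightarrow> ('x, 'j, 'f::real_normed_vector) ac_manifold \<Rightarrow>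
   nat \<Rightarrow> ('y, ('y, ('y, 'x) tuple_class) germs) presheaf" where
  "jcor_n_sheaf Y X n = sheafify (mtop Y) (tuple_presheaf Y X n)"

definition JCor_n ::
  "nat \<Rightarrow> ('y, 'i, 'e::real_normed_vector) ac_manifold \<Rightarrow> ('x, 'j, 'f::real_normed_vector) ac_manifold \<Rightarrow>
   ('y, ('y, 'x) tuple_class) germs set" where
  "JCor_n n Y X = sect (jcor_n_sheaf Y X n) (topspace (mtop Y))"

definition coprod_presheaf ::
  "('y, 'i, 'e::real_normed_vector) ac_manifold \<Rightarrow> ('x, 'j, 'f::real_normed_vector) ac_manifold \<Rightarrow>
   ('y, nat \<times> ('y, ('y, 'x) tuple_class) germs) presheaf" where
  "coprod_presheaf Y X =
     \<lparr>sect = (\<lambda>U. SIGMA n:UNIV. sect (jcor_n_sheaf Y X n) U),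
      res = (\<lambda>U V (n, \<sigma>). (n, res (jcor_n_sheaf Y X n) U V \<sigma>))\<rparr>"

type_synonym ('y, 'x) jcor = "('y, nat \<times> ('y, ('y, 'x) tuple_class) germs) germs"

definition JCor ::
  "('y, 'i, 'e::real_normed_vector) ac_manifold \<Rightarrow> ('x, 'j, 'f::real_normed_vector) ac_manifold \<Rightarrow>
   ('y, 'x) jcor set" where
  "JCor Y X = sect (sheafify (mtop Y) (coprod_presheaf Y X)) (topspace (mtop Y))"

definition tuple_add ::
  "('y, 'i, 'e::real_normed_vector) ac_manifold \<Rightarrow> ('x, 'j, 'f::real_normed_vector) ac_manifold \<Rightarrow>
   nat \<Rightarrow> nat \<Rightarrow> 'y set \<Rightarrow> ('y, 'x) tuple_class \<Rightarrow> ('y, 'x) tuple_class \<Rightarrow> ('y, 'x) tuple_class" where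
  "tuple_add Y X n m U c d = (\<Union>A\<in>c. \<Union>B\<in>d. tuple_rel Y X (n + m) U `` {A + B})"

definition coprod_add ::
  "('y, 'i, 'e::real_normed_vector) ac_manifold \<Rightarrow> ('x, 'j, 'f::real_normed_vector) ac_manifold \<Rightarrow>
   'y set \<Rightarrow> nat \<times> ('y, ('y, 'x) tuple_class) germs \<Rightarrow> nat \<times> ('y, ('y, 'x) tuple_class) germs \<Rightarrow>
   nat \<times> ('y, ('y, 'x) tuple_class) germs" where
  "coprod_add Y X U = (\<lambda>(n, \<sigma>) (m, \<tau>).
     (n + m, sheafify_map2 (mtop Y) (tuple_presheaf Y X n) (tuple_presheaf Y X m)
               (tuple_presheaf Y X (n + m)) (tuple_add Y X n m) U \<sigma> \<tau>))"

definition JCor_add ::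
  "('y, 'i, 'e::real_normed_vector) ac_manifold \<Rightarrow> ('x, 'j, 'f::real_normed_vector) ac_manifold \<Rightarrow>
   ('y, 'x) jcor \<Rightarrow> ('y, 'x) jcor \<Rightarrow> ('y, 'x) jcor" where
  "JCor_add Y X =
     sheafify_map2 (mtop Y) (coprod_presheaf Y X) (coprod_presheaf Y X) (coprod_presheaf Y X)
       (coprod_add Y X) (topspace (mtop Y))"

definition empty_corr_n ::
  "('y, 'i, 'e::real_normed_vector) ac_manifold \<Rightarrow> ('x, 'j, 'f::real_normed_vector) ac_manifold \<Rightarrow>
   ('y, ('y, 'x) tuple_class) germs" where
  "empty_corr_n Y X =
     (\<lambda>y\<in>topspace (mtop Y). germ (mtop Y) (tuple_presheaf Y X 0) y (topspace (mtop Y)) {{#}})"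

definition empty_corr ::
  "('y, 'i, 'e::real_normed_vector) ac_manifold \<Rightarrow> ('x, 'j, 'f::real_normed_vector) ac_manifold \<Rightarrow>
   ('y, 'x) jcor" where
  "empty_corr Y X =
     (\<lambda>y\<in>topspace (mtop Y).
        germ (mtop Y) (coprod_presheaf Y X) y (topspace (mtop Y)) (0, empty_corr_n Y X))"

definition JCor_monoid ::
  "('y, 'i, 'e::real_normed_vector) ac_manifold \<Rightarrow> ('x, 'j, 'f::real_normed_vector) ac_manifold \<Rightarrow>
   ('y, 'x) jcor monoid" where
  "JCor_monoid Y X = \<lparr>carrier = JCor Y X, mult = JCor_add Y X, one = empty_corr Y X\<rparr>"

definition tuple_pullback ::
  "('y, 'i, 'e::real_normed_vector) ac_manifold \<Rightarrow> ('x, 'j, 'f::real_normed_vector) ac_manifold \<Rightarrow>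
   ('y \<Rightarrow> 'z) \<Rightarrow> nat \<Rightarrow> 'z set \<Rightarrow> ('z, 'x) tuple_class \<Rightarrow> ('y, 'x) tuple_class" where
  "tuple_pullback Y X h n V c =
     (\<Union>A\<in>c. tuple_rel Y X n (preim (mtop Y) h V) ``
              {image_mset (\<lambda>f. restrict (f \<circ> h) (preim (mtop Y) h V)) A})"

definition coprod_pullback ::
  "('y, 'i, 'e::real_normed_vector) ac_manifold \<Rightarrow> ('z, 'k, 'g::real_normed_vector) ac_manifold \<Rightarrow>
   ('x, 'j, 'f::real_normed_vector) ac_manifold \<Rightarrow> ('y \<Rightarrow> 'z) \<Rightarrow> 'z set \<Rightarrow>
   nat \<times> ('z, ('z, 'x) tuple_class) germs \<Rightarrow> nat \<times> ('y, ('y, 'x) tuple_class) germs" where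
  "coprod_pullback Y Y' X h U = (\<lambda>(n, \<sigma>).
     (n, sheafify_pullback (mtop Y) (mtop Y') h (tuple_presheaf Y' X n) (tuple_presheaf Y X n)
           (tuple_pullback Y X h n) U \<sigma>))"

definition JCor_pullback ::
  "('y, 'i, 'e::real_normed_vector) ac_manifold \<Rightarrow> ('z, 'k, 'g::real_normed_vector) ac_manifold \<Rightarrow>
   ('x, 'j, 'f::real_normed_vector) ac_manifold \<Rightarrow> ('y \<Rightarrow> 'z) \<Rightarrow> ('z, 'x) jcor \<Rightarrow> ('y, 'x) jcor" where
  "JCor_pullback Y Y' X h =
     sheafify_pullback (mtop Y) (mtop Y') h (coprod_presheaf Y' X) (coprod_presheaf Y X)
       (coprod_pullback Y Y' X h) (topspace (mtop Y'))"


section \<open>Grothendieck groups\<close>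

text \<open>The class of \<open>(a, b)\<close> is the formal difference \<open>a - b\<close>.\<close>

definition grothendieck_rel :: "('a, 'z) monoid_scheme \<Rightarrow> (('a \<times> 'a) \<times> ('a \<times> 'a)) set" where
  "grothendieck_rel G =
     {((a, b), (c, d)). a \<in> carrier G \<and> b \<in> carrier G \<and> c \<in> carrier G \<and> d \<in> carrier G \<and>
        (\<exists>k\<in>carrier G. (a \<otimes>\<^bsub>G\<^esub> d) \<otimes>\<^bsub>G\<^esub> k = (c \<otimes>\<^bsub>G\<^esub> b) \<otimes>\<^bsub>G\<^esub> k)}"

definition grothendieck_group :: "('a, 'z) monoid_scheme \<Rightarrow> ('a \<times> 'a) set monoid" where
  "grothendieck_group G =
     \<lparr>carrier = (carrier G \<times> carrier G) // grothendieck_rel G,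
      mult = (\<lambda>p q. \<Union>(a, b)\<in>p. \<Union>(c, d)\<in>q. grothendieck_rel G `` {(a \<otimes>\<^bsub>G\<^esub> c, b \<otimes>\<^bsub>G\<^esub> d)}),
      one = grothendieck_rel G `` {(\<one>\<^bsub>G\<^esub>, \<one>\<^bsub>G\<^esub>)}\<rparr>"

definition grothendieck_map ::
  "('b, 'z) monoid_scheme \<Rightarrow> ('a \<Rightarrow> 'b) \<Rightarrow> ('a \<times> 'a) set \<Rightarrow> ('b \<times> 'b) set" where
  "grothendieck_map H \<phi> p = (\<Union>(a, b)\<in>p. grothendieck_rel H `` {(\<phi> a, \<phi> b)})"

type_synonym ('y, 'x) jc = "(('y, 'x) jcor \<times> ('y, 'x) jcor) set"

definition JC ::
  "('y, 'i, 'e::real_normed_vector) ac_manifold \<Rightarrow> ('x, 'j, 'f::real_normed_vector) ac_manifold \<Rightarrow>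
   ('y, 'x) jc monoid" where
  "JC Y X = grothendieck_group (JCor_monoid Y X)"

text \<open>\<open>JC_comp Y Y' X H h\<close> is \<open>H \<circ> h\<close> for a pseudoholomorphic map \<open>h\<close> from \<open>Y\<close> to \<open>Y'\<close>.\<close>

definition JC_comp ::
  "('y, 'i, 'e::real_normed_vector) ac_manifold \<Rightarrow> ('z, 'k, 'g::real_normed_vector) ac_manifold \<Rightarrow>
   ('x, 'j, 'f::real_normed_vector) ac_manifold \<Rightarrow> ('z, 'x) jc \<Rightarrow> ('y \<Rightarrow> 'z) \<Rightarrow> ('y, 'x) jc" where
  "JC_comp Y Y' X H h = grothendieck_map (JCor_monoid Y X) (JCor_pullback Y Y' X h) H"

definition M_homotopy_rel ::
  "('m, 'k, 'g::real_normed_vector) ac_manifold \<Rightarrow> 'm \<Rightarrow> 'm \<Rightarrow>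
   ('y, 'i, 'e::real_normed_vector) ac_manifold \<Rightarrow> ('x, 'j, 'f::real_normed_vector) ac_manifold \<Rightarrow>
   (('y, 'x) jc \<times> ('y, 'x) jc) set" where
  "M_homotopy_rel M p\<^sub>0 p\<^sub>1 Y X =
     {(F, G). F \<in> carrier (JC Y X) \<and> G \<in> carrier (JC Y X) \<and>
        (\<exists>H\<in>carrier (JC (prod_manifold Y M) X).
           JC_comp Y (prod_manifold Y M) X H (\<lambda>y. (y, p\<^sub>0)) = F \<and>
           JC_comp Y (prod_manifold Y M) X H (\<lambda>y. (y, p\<^sub>1)) = G)}"


lemma sect_tuple_presheaf_0: "sect (tuple_presheaf Y X 0) U = {{{#}}}"
proof -
  have t: "tuples Y X 0 U = {{#}}"
    by (auto simp: tuples_def)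
  have "tuple_rel Y X 0 U = {({#}, {#})}"
    unfolding tuple_rel_def t by auto
  with t show ?thesis
    by (auto simp: tuple_presheaf_def quotient_def)
qed

lemma res_tuple_presheaf_0: "res (tuple_presheaf Y X 0) U V {{#}} = {{#}}"
  by (auto simp: tuple_presheaf_def tuple_rel_def tuples_def)

lemma jcor_n_0: "JCor_n 0 Y X = {empty_corr_n Y X}"
proof -
  let ?T = "mtop Y" let ?P = "tuple_presheaf Y X 0"
  have germ_sub: "germ ?T ?P y U {{#}} \<subseteq> germ ?T ?P y V {{#}}"
    if U: "openin ?T U" "y \<in> U" and V: "openin ?T V" "y \<in> V" for y U V
  proof (rule subsetI, clarify)
    fix W t assume "(W, t) \<in> germ ?T ?P y U {{#}}"
    then have W: "openin ?T W" "y \<in> W" "t \<in> sect ?P W"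
      by (auto simp: germ_def)
    then have t: "t = {{#}}"
      by (simp add: sect_tuple_presheaf_0)
    have "openin ?T (V \<inter> W)" "y \<in> V \<inter> W"
      using V W by auto
    then show "(W, t) \<in> germ ?T ?P y V {{#}}"
      unfolding germ_def using W t by (auto simp: res_tuple_presheaf_0 intro!: exI[of _ "V \<inter> W"])
  qed
  have germ: "germ ?T ?P y V {{#}} = germ ?T ?P y (topspace ?T) {{#}}"
    if "openin ?T V" "y \<in> V" for y V
    using that openin_subset[OF that(1)] by (intro subset_antisym germ_sub) auto
  have "\<exists>V s. openin ?T V \<and> x \<in> V \<and> V \<subseteq> topspace ?T \<and> s \<in> sect ?P V \<and>
          (\<forall>y\<in>V. empty_corr_n Y X y = germ ?T ?P y V s)" if "x \<in> topspace ?T" for x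
    using that by (intro exI[of _ "topspace ?T"] exI[of _ "{{#}}"])
      (simp add: sect_tuple_presheaf_0 empty_corr_n_def)
  then have "empty_corr_n Y X \<in> JCor_n 0 Y X"
    by (simp add: JCor_n_def jcor_n_sheaf_def sheafify_def empty_corr_n_def)
  moreover have "\<sigma> = empty_corr_n Y X" if "\<sigma> \<in> JCor_n 0 Y X" for \<sigma>
  proof (rule extensionalityI)
    show "\<sigma> \<in> extensional (topspace ?T)"
      using that by (simp add: JCor_n_def jcor_n_sheaf_def sheafify_def)
    show "empty_corr_n Y X \<in> extensional (topspace ?T)"
      by (simp add: empty_corr_n_def)
    show "\<sigma> y = empty_corr_n Y X y" if y: "y \<in> topspace ?T" for y
    proof -
      have "\<forall>x\<in>topspace ?T. \<exists>V s. openin ?T V \<and> x \<in> V \<and> V \<subseteq> topspace ?T \<and> s \<in> sect ?P V \<and>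
              (\<forall>y\<in>V. \<sigma> y = germ ?T ?P y V s)"
        using \<open>\<sigma> \<in> JCor_n 0 Y X\<close> by (simp add: JCor_n_def jcor_n_sheaf_def sheafify_def)
      then obtain V s where V: "openin ?T V" "y \<in> V" and s: "s \<in> sect ?P V" "\<sigma> y = germ ?T ?P y V s"
        using y by metis
      have "s = {{#}}"
        using s(1) by (simp only: sect_tuple_presheaf_0 singleton_iff)
      with s(2) germ[OF V] y show ?thesis
        by (simp add: empty_corr_n_def)
    qed
  qed
  ultimately show ?thesis by blast
qed

end

theory Submission
  imports Defs
begin

text \<open>
  Two homotopies \<open>H\<close> from \<open>F\<close> to \<open>G\<close> and \<open>H'\<close> from \<open>G\<close> to \<open>K\<close> are concatenated without any gluing: since
  \<open>JC\<close> takes values in groups, \<open>H + H' - G \<circ> fst\<close> is a homotopy from \<open>F\<close> to \<open>K\<close>.  Reflexivity comes from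
  \<open>F \<circ> fst\<close> and symmetry from \<open>H \<circ> (id \<times> \<gamma>)\<close>.  What has to be supplied is that correspondences can be
  pulled back along pseudoholomorphic maps, compatibly with addition and composition.  For this,
  a correspondence is identified with the map that sends a point \<open>y\<close> to the multiset of its values
  at \<open>y\<close>.  This map determines the correspondence, turns addition into multiset addition and pullback
  into composition, so all identities become pointwise identities of multisets.
\<close>

section \<open>Smooth maps between finite-dimensional spaces\<close>

text \<open>Pulling back tuples rests on the chain rule to all orders. \<open>Ck_on\<close>
  differentiates in fixed directions only, whereas the derivative of a composite is taken in a
  direction that moves with the point. Expanding this direction in a basis removes the difficulty;
  since model spaces are only normed spaces with a finite spanning set, the coordinates first have
  to be shown bounded. Tuples are identified exactly when their value multisets agree, so a germ
  amounts to the values near a point, and the size \<open>n\<close> of a tuple is the size of any of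
  its values. \<open>JCor\<close> sheafifies twice, hence determination by values is formulated as a
  property of presheaves that passes to sheafifications. The term subtracted in the concatenation
  does not depend on the point of \<open>M\<close>: at \<open>p\<^sub>0\<close> it cancels the start
  of the second homotopy, at \<open>p\<^sub>1\<close> the end of the first.\<close>

text \<open>
  All norms on a finite-dimensional space are equivalent: the coordinate functionals of a basis are
  bounded because the norm attains a positive minimum on the unit sphere of the maximum norm.
\<close>

lemma independent_norm_bound:
  fixes B :: "'a::real_normed_vector set"
  assumes "finite B" "independent B"
  obtains m where "m > 0" "\<And>u b. b \<in> B \<Longrightarrow> m * \<bar>u b\<bar> \<le> norm (\<Sum>b\<in>B. u b *\<^sub>R b)"
proof -
  define N where "N u = norm (\<Sum>b\<in>B. u b *\<^sub>R b)" for u :: "'a \<Rightarrow> real"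
  \<comment> \<open>Coefficients are functions on the whole type; pinning those outside
    \<open>B\<close> to 0 makes the box compact by Tychonoff. \<open>K\<close> is then the unit
    sphere of the maximum norm, empty exactly when \<open>B\<close> is.\<close>
  define S where "S b = (if b \<in> B then {-1..1::real} else {0})" for b
  define K where "K = (\<Pi>\<^sub>E b\<in>UNIV. S b) \<inter> (\<Union>b\<in>B. {u. \<bar>u b\<bar> = 1})"
  have "compactin (product_topology (\<lambda>_. euclidean) UNIV) (\<Pi>\<^sub>E b\<in>UNIV. S b)"
    by (subst compactin_PiE) (auto simp: S_def)
  then have "compact (\<Pi>\<^sub>E b\<in>UNIV. S b)"
    by (simp add: euclidean_product_topology)
  moreover have "closed {u :: 'a \<Rightarrow> real. \<bar>u b\<bar> = 1}" for b
    by (intro closed_Collect_eq continuous_on_rabs continuous_on_const continuous_on_product_coordinates)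
  ultimately have K: "compact K"
    unfolding K_def using assms(1) by (intro compact_Int_closed closed_UN) blast+
  have N: "continuous_on K N"
    unfolding N_def by (intro continuous_on_norm continuous_on_sum continuous_on_scaleR
        continuous_on_const continuous_on_subset[OF continuous_on_product_coordinates]) auto
  have pos: "N u > 0" if "u \<in> K" for u
  proof (rule ccontr)
    assume "\<not> N u > 0"
    then have "(\<Sum>b\<in>B. u b *\<^sub>R b) = 0" by (simp add: N_def)
    then have "u b = 0" if "b \<in> B" for b
      using real_vector.independentD[OF assms(2,1) order_refl] that by blast
    with \<open>u \<in> K\<close> show False by (auto simp: K_def)
  qed
  obtain m where m: "m > 0" "\<And>u. u \<in> K \<Longrightarrow> m \<le> N u"
  proof (cases "K = {}")
    case True
    then show ?thesis using that[of 1] by simp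
  next
    case False
    then obtain u\<^sub>0 where "u\<^sub>0 \<in> K" "\<forall>u\<in>K. N u\<^sub>0 \<le> N u"
      using continuous_attains_inf[OF K _ N] by blast
    then show ?thesis using that[of "N u\<^sub>0"] pos by blast
  qed
  have "m * \<bar>u b\<bar> \<le> N u" if "b \<in> B" for u b
  proof -
    define t where "t = Max ((\<lambda>b. \<bar>u b\<bar>) ` B)"
    have le: "\<bar>u b'\<bar> \<le> t" if "b' \<in> B" for b'
      unfolding t_def using assms(1) that by simp
    have "t \<in> (\<lambda>b. \<bar>u b\<bar>) ` B"
      unfolding t_def using assms(1) \<open>b \<in> B\<close> by (intro Max_in) auto
    then obtain b\<^sub>0 where b0: "b\<^sub>0 \<in> B" "t = \<bar>u b\<^sub>0\<bar>" by blast
    show ?thesis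
    proof (cases "t = 0")
      case True
      with le[OF that] show ?thesis by (simp add: N_def)
    next
      case False
      then have t: "t > 0" using b0 by linarith
      \<comment> \<open>Rescaling by the largest coefficient \<open>t\<close> puts \<open>u\<close>
        on the sphere \<open>K\<close>; the lower bound there scales back to
        \<open>m * t\<close>.\<close>
      define w where "w b = (if b \<in> B then u b / t else 0)" for b
      have "w b' \<in> S b'" for b'
        using le[of b'] t by (auto simp: w_def S_def abs_le_iff field_simps)
      moreover have "\<bar>w b\<^sub>0\<bar> = 1" using b0 t by (simp add: w_def abs_divide)
      ultimately have "w \<in> K" using b0(1) by (auto simp: K_def)
      then have "m \<le> N w" by (rule m(2))
      also have "(\<Sum>b\<in>B. w b *\<^sub>R b) = (1 / t) *\<^sub>R (\<Sum>b\<in>B. u b *\<^sub>R b)"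
        unfolding scaleR_sum_right by (intro sum.cong) (auto simp: w_def)
      then have "N w = N u / t" using t by (simp add: N_def)
      finally have "m * t \<le> N u" using t by (simp add: field_simps)
      moreover have "m * \<bar>u b\<bar> \<le> m * t" using le[OF that] m(1) by simp
      ultimately show ?thesis by linarith
    qed
  qed
  with m(1) that show ?thesis unfolding N_def by blast
qed

text \<open>The basis is extracted from the spanning set, and the preceding bound, applied to the
  coefficients of \<open>x\<close>, bounds each coordinate functional with constant
  \<open>1 / m\<close>. This serves to expand directions of derivatives.\<close>

lemma finite_dim_coordinates:
  fixes B :: "'a::real_normed_vector set"
  assumes "finite B" "span B = UNIV"
  obtains B' :: "'a set" and c where "finite B'" "\<And>b. b \<in> B' \<Longrightarrow> bounded_linear (c b)"
    "\<And>x. (\<Sum>b\<in>B'. c b x *\<^sub>R b) = x"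
proof -
  obtain B' where B': "B' \<subseteq> B" "independent B'" "B \<subseteq> span B'"
    using real_vector.maximal_independent_subset[of B] by blast
  have fin: "finite B'" using B'(1) assms(1) by (rule finite_subset)
  have span: "x \<in> span B'" for x
    using real_vector.span_minimal[OF B'(3) real_vector.subspace_span] assms(2) by blast
  define c where "c b x = representation B' x b" for b x
  have expand: "(\<Sum>b\<in>B'. c b x *\<^sub>R b) = x" for x
    unfolding c_def by (rule real_vector.sum_representation_eq[OF B'(2) span fin order_refl])
  obtain m where m: "m > 0" "\<And>u b. b \<in> B' \<Longrightarrow> m * \<bar>u b\<bar> \<le> norm (\<Sum>b\<in>B'. u b *\<^sub>R b)"
    using independent_norm_bound[OF fin B'(2)] by blast
  have "bounded_linear (c b)" if "b \<in> B'" for b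
  proof (rule bounded_linear_intro)
    show "norm (c b x) \<le> norm x * (1 / m)" for x
      using m(2)[OF that, of "\<lambda>b. c b x"] m(1) by (simp add: expand field_simps)
    show "c b (x + y) = c b x + c b y" for x y
      unfolding c_def by (simp add: real_vector.representation_add[OF B'(2) span span])
    show "c b (r *\<^sub>R x) = r *\<^sub>R c b x" for r x
      unfolding c_def by (simp add: real_vector.representation_scale[OF B'(2) span])
  qed
  then show ?thesis
    using that[OF fin _ expand] by blast
qed

section \<open>Calculus of maps of class C^k\<close>

lemma frechet_derivative_transform_open:
  assumes "f differentiable at x" "open S" "x \<in> S" "\<And>y. y \<in> S \<Longrightarrow> f y = g y"
  shows "g differentiable at x" "frechet_derivative g (at x) = frechet_derivative f (at x)"
proof -
  have "(g has_derivative frechet_derivative f (at x)) (at x)"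
    using assms(1) assms(2-4)
    by (auto simp: frechet_derivative_works intro: has_derivative_transform_within_open)
  then show "g differentiable at x" "frechet_derivative g (at x) = frechet_derivative f (at x)"
    by (rule Derivative.differentiableI, rule frechet_derivative_at[symmetric])
qed

lemma Ck_on_cong:
  assumes "Ck_on k S f" "open S" "\<And>x. x \<in> S \<Longrightarrow> f x = g x"
  shows "Ck_on k S g"
  using assms
proof (induction k arbitrary: f g)
  case 0
  then have "continuous_on S f" by simp
  then have "continuous_on S g" by (rule continuous_on_eq) (rule 0)
  then show ?case by simp
next
  case (Suc k)
  have f: "\<forall>x\<in>S. f differentiable at x" "\<And>v. Ck_on k S (\<lambda>x. frechet_derivative f (at x) v)"
    using Suc.prems(1) by simp_all
  note g = frechet_derivative_transform_open[OF bspec[OF f(1)] Suc.prems(2) _ Suc.prems(3)]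
  have "Ck_on k S (\<lambda>x. frechet_derivative g (at x) v)" for v
    by (rule Suc.IH[OF f(2) Suc.prems(2)]) (simp only: g(2))
  then show ?case by (simp add: g(1))
qed

text \<open>Derivatives in \<open>Ck_on\<close> are taken at the point rather than within the set,
  so they do not change when the set shrinks.\<close>

lemma Ck_on_subset: "Ck_on k S f \<Longrightarrow> T \<subseteq> S \<Longrightarrow> Ck_on k T f"
  by (induction k arbitrary: f) (auto intro: continuous_on_subset)

lemma Ck_on_local:
  assumes "\<And>x. x \<in> S \<Longrightarrow> \<exists>T. open T \<and> x \<in> T \<and> Ck_on k T f"
  shows "Ck_on k S f"
  using assms
proof (induction k arbitrary: f)
  case 0
  then have "isCont f x" if "x \<in> S" for x
    using that by (meson Ck_on.simps(1) continuous_on_eq_continuous_at)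
  then show ?case by (simp add: continuous_at_imp_continuous_on)
next
  case (Suc k)
  have "Ck_on k S (\<lambda>x. frechet_derivative f (at x) v)" for v
  proof (rule Suc.IH)
    fix x assume "x \<in> S"
    then obtain T where "open T" "x \<in> T" "Ck_on (Suc k) T f"
      using Suc.prems by blast
    then show "\<exists>T. open T \<and> x \<in> T \<and> Ck_on k T (\<lambda>x. frechet_derivative f (at x) v)"
      by (intro exI[of _ T]) simp
  qed
  moreover have "f differentiable at x" if "x \<in> S" for x
    using Suc.prems[OF that] by auto
  ultimately show ?case by simp
qed

text \<open>The recursion lowers the order only of the derivatives, so the descent is carried by
  induction down to the fact that differentiable maps are continuous.\<close>

lemma Ck_on_Suc:
  assumes "Ck_on (Suc k) S f"
  shows "Ck_on k S f"
  using assms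
proof (induction k arbitrary: f)
  case 0
  then have "isCont f x" if "x \<in> S" for x
    using that by (simp add: differentiable_imp_continuous_within)
  then show ?case by (simp add: continuous_at_imp_continuous_on)
next
  case (Suc k)
  have "Ck_on k S (\<lambda>x. frechet_derivative f (at x) v)" for v
    using Suc.prems by (intro Suc.IH) (simp only: Ck_on.simps(2)[of "Suc k"])
  moreover have "\<forall>x\<in>S. f differentiable at x"
    using Suc.prems by simp
  ultimately show ?case by simp
qed

lemma Ck_on_const: "Ck_on k S (\<lambda>x. c)"
  by (induction k arbitrary: c) auto

lemma frechet_derivative_eq: "(f has_derivative D) (at x) \<Longrightarrow> frechet_derivative f (at x) = D"
  by (rule frechet_derivative_at[symmetric])

text \<open>\<open>frechet_derivative\<close> is defined by choice; by uniqueness of derivatives an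
  explicit family \<open>D\<close> can take its place.\<close>

lemma Ck_on_SucI:
  assumes "open S" "\<And>x. x \<in> S \<Longrightarrow> (f has_derivative D x) (at x)"
    and "\<And>v. Ck_on k S (\<lambda>x. D x v)"
  shows "Ck_on (Suc k) S f"
proof -
  have "Ck_on k S (\<lambda>x. frechet_derivative f (at x) v)" for v
    by (rule Ck_on_cong[OF assms(3) assms(1)]) (simp add: frechet_derivative_eq[OF assms(2)])
  then show ?thesis
    using assms(2) by (auto simp: differentiable_def)
qed

lemma Ck_on_SucD:
  assumes "Ck_on (Suc k) S f" "x \<in> S"
  shows "(f has_derivative frechet_derivative f (at x)) (at x)"
  using assms by (simp add: frechet_derivative_works)

lemma Ck_on_bounded_linear:
  assumes "bounded_linear L" "open S"
  shows "Ck_on k S L"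
proof (cases k)
  case 0
  then show ?thesis using assms by (simp add: linear_continuous_on)
next
  case (Suc k')
  show ?thesis unfolding Suc
    by (rule Ck_on_SucI[OF assms(2), of _ "\<lambda>_. L"])
      (auto intro: bounded_linear_imp_has_derivative assms Ck_on_const)
qed

lemma Ck_on_bounded_linear_comp:
  assumes "bounded_linear L" "open S" "Ck_on k S f"
  shows "Ck_on k S (\<lambda>x. L (f x))"
  using assms(3)
proof (induction k arbitrary: f)
  case 0
  then show ?case by (simp add: bounded_linear.continuous_on[OF assms(1)])
next
  case (Suc k)
  show ?case
    by (rule Ck_on_SucI[OF assms(2) bounded_linear.has_derivative[OF assms(1) Ck_on_SucD[OF Suc.prems]]])
      (use Suc in auto)
qed

lemma Ck_on_add:
  assumes "open S" "Ck_on k S f" "Ck_on k S g"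
  shows "Ck_on k S (\<lambda>x. f x + g x)"
  using assms(2,3)
proof (induction k arbitrary: f g)
  case 0
  then show ?case by (simp add: continuous_on_add)
next
  case (Suc k)
  show ?case
    by (rule Ck_on_SucI[OF assms(1) has_derivative_add[OF Ck_on_SucD[OF Suc.prems(1)] Ck_on_SucD[OF Suc.prems(2)]]])
      (use Suc in auto)
qed

lemma Ck_on_sum:
  assumes "open S" "\<And>b. b \<in> B \<Longrightarrow> Ck_on k S (f b)"
  shows "Ck_on k S (\<lambda>x. \<Sum>b\<in>B. f b x)"
  using assms(2)
  by (induction B rule: infinite_finite_induct) (auto intro: Ck_on_const Ck_on_add assms(1))

text \<open>Product rule. Each term of the derivative multiplies a directional derivative, of class
  C^k, by an undifferentiated factor, which \<open>Ck_on_Suc\<close> brings down to the same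
  class.\<close>

lemma Ck_on_scaleR:
  fixes c :: "'a::real_normed_vector \<Rightarrow> real"
  assumes "open S" "Ck_on k S c" "Ck_on k S f"
  shows "Ck_on k S (\<lambda>x. c x *\<^sub>R f x)"
  using assms(2,3)
proof (induction k arbitrary: c f)
  case 0
  then show ?case by (simp add: continuous_on_scaleR)
next
  case (Suc k)
  have "Ck_on k S c" "Ck_on k S f"
    using Suc.prems[THEN Ck_on_Suc] by simp_all
  moreover have "Ck_on k S (\<lambda>x. frechet_derivative c (at x) v)"
      "Ck_on k S (\<lambda>x. frechet_derivative f (at x) v)" for v
    using Suc.prems by simp_all
  ultimately have *: "Ck_on k S (\<lambda>x. c x *\<^sub>R frechet_derivative f (at x) v + frechet_derivative c (at x) v *\<^sub>R f x)" for v
    by (intro Ck_on_add assms(1) Suc.IH)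
  show ?case
    by (rule Ck_on_SucI[OF assms(1) has_derivative_scaleR[OF Ck_on_SucD[OF Suc.prems(1)] Ck_on_SucD[OF Suc.prems(2)]] *])
qed

text \<open>The pair is the sum of the images of \<open>f\<close> and \<open>g\<close> under the two
  axis embeddings, which are bounded linear.\<close>

lemma Ck_on_Pair:
  fixes f :: "'a::real_normed_vector \<Rightarrow> 'b::real_normed_vector" and g :: "'a \<Rightarrow> 'c::real_normed_vector"
  assumes "open S" "Ck_on k S f" "Ck_on k S g"
  shows "Ck_on k S (\<lambda>x. (f x, g x))"
proof -
  have "bounded_linear (\<lambda>y::'b. (y, 0::'c))" "bounded_linear (Pair 0 :: 'c \<Rightarrow> 'b \<times> 'c)"
    by (intro bounded_linear_Pair bounded_linear_ident bounded_linear_zero)+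
  from Ck_on_add[OF assms(1) this[THEN Ck_on_bounded_linear_comp, OF assms(1)], OF assms(2,3)]
  show ?thesis by simp
qed

text \<open>The direction in which \<open>g\<close> is differentiated varies with \<open>x\<close>.
  Expanded in a basis, the derivative becomes a finite sum of scalar C^k coefficients times
  derivatives of \<open>g\<close> in fixed directions, composed with \<open>f\<close>. This is why
  the finite spanning set is asked of the intermediate space.\<close>

lemma Ck_on_compose:
  fixes f :: "'a::real_normed_vector \<Rightarrow> 'b::real_normed_vector" and g :: "'b \<Rightarrow> 'c::real_normed_vector"
  assumes "finite B" "span B = (UNIV :: 'b set)" "open S"
    and "Ck_on k S f" "Ck_on k T g" "f ` S \<subseteq> T"
  shows "Ck_on k S (\<lambda>x. g (f x))"
  using assms(4-6)
proof (induction k arbitrary: f g)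
  case 0
  then show ?case using continuous_on_compose2[of T g S f] by simp
next
  case (Suc k)
  obtain B' :: "'b set" and c where B': "finite B'" "\<And>b. b \<in> B' \<Longrightarrow> bounded_linear (c b)"
    "\<And>x. (\<Sum>b\<in>B'. c b x *\<^sub>R b) = x"
    by (rule finite_dim_coordinates[OF assms(1,2)]) (rule that)
  let ?Df = "\<lambda>x. frechet_derivative f (at x)"
  let ?Dg = "\<lambda>x. frechet_derivative g (at x)"
  have *: "((\<lambda>x. g (f x)) has_derivative (\<lambda>v. ?Dg (f x) (?Df x v))) (at x)" if "x \<in> S" for x
    using diff_chain_at[OF Ck_on_SucD[OF Suc.prems(1) that] Ck_on_SucD[OF Suc.prems(2), of "f x"]]
      that Suc.prems(3) by (auto simp: o_def)
  show ?case
  proof (rule Ck_on_SucI[OF assms(3) *])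
    fix v
    have Df: "Ck_on k S (\<lambda>x. ?Df x v)"
      using Suc.prems(1) by simp
    \<comment> \<open>The induction hypothesis is applied to a directional derivative of
      \<open>g\<close> and to \<open>f\<close> itself, used here only as a map of class C^k.\<close>
    have Dg: "Ck_on k S (\<lambda>x. ?Dg (f x) b)" for b
      using Suc.prems Ck_on_Suc[OF Suc.prems(1)] by (intro Suc.IH[of f "\<lambda>y. ?Dg y b"]) simp_all
    have "Ck_on k S (\<lambda>x. \<Sum>b\<in>B'. c b (?Df x v) *\<^sub>R ?Dg (f x) b)"
      by (rule Ck_on_sum[OF assms(3)],
          rule Ck_on_scaleR[OF assms(3) Ck_on_bounded_linear_comp[OF B'(2) assms(3) Df] Dg])
    moreover have "(\<Sum>b\<in>B'. c b (?Df x v) *\<^sub>R ?Dg (f x) b) = ?Dg (f x) (?Df x v)" if "x \<in> S" for x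
    proof -
      have "linear (?Dg (f x))"
        using Suc.prems that by (auto intro!: linear_frechet_derivative)
      then have "?Dg (f x) (\<Sum>b\<in>B'. c b (?Df x v) *\<^sub>R b) = (\<Sum>b\<in>B'. c b (?Df x v) *\<^sub>R ?Dg (f x) b)"
        by (simp add: linear_sum linear_scale)
      then show ?thesis by (simp add: B'(3))
    qed
    ultimately show "Ck_on k S (\<lambda>x. ?Dg (f x) (?Df x v))"
      by (rule Ck_on_cong[OF _ assms(3)])
  qed
qed

section \<open>Pseudoholomorphic maps\<close>

text \<open>What computations in charts rely on, in a form that products and open submanifolds
  inherit. The last clause turns open subsets of a chart domain into open subsets of the model
  space, on which derivatives make sense.\<close>

definition smooth_atlas :: "('a, 'i, 'e::real_normed_vector, 'z) manifold_scheme \<Rightarrow> bool" where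
  "smooth_atlas X \<longleftrightarrow>
     (\<exists>B::'e set. finite B \<and> span B = UNIV) \<and>
     topspace (mtop X) = (\<Union>i\<in>idx X. cdom X i) \<and>
     (\<forall>i\<in>idx X. openin (mtop X) (cdom X i) \<and> inj_on (chart X i) (cdom X i) \<and>
        (\<forall>W\<subseteq>cdom X i. openin (mtop X) W \<longrightarrow> open (chart X i ` W)))"

lemma smooth_atlas_smooth_manifold:
  assumes "smooth_manifold X"
  shows "smooth_atlas X"
proof -
  have "inj_on (chart X i) (cdom X i) \<and> (\<forall>W\<subseteq>cdom X i. openin (mtop X) W \<longrightarrow> open (chart X i ` W))"
    if i: "i \<in> idx X" for i
  proof -
    let ?T = "subtopology (mtop X) (cdom X i)"
    have o: "openin (mtop X) (cdom X i)" "open (chart X i ` cdom X i)"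
      and h: "homeomorphic_map ?T (top_of_set (chart X i ` cdom X i)) (chart X i)"
      using assms i by (auto simp: smooth_manifold_def)
    have ts: "topspace ?T = cdom X i"
      using openin_subset[OF o(1)] by auto
    have "open (chart X i ` W)" if "W \<subseteq> cdom X i" "openin (mtop X) W" for W
    proof -
      have "openin ?T W"
        using that by (metis inf.absorb_iff2 openin_subtopology_Int2 inf_commute)
      then have "openin (top_of_set (chart X i ` cdom X i)) (chart X i ` W)"
        using h by (metis homeomorphic_imp_open_map open_map_def)
      then show ?thesis using o(2) openin_open_eq by blast
    qed
    moreover have "inj_on (chart X i) (cdom X i)"
      using homeomorphic_imp_injective_map[OF h] ts by simp
    ultimately show ?thesis by blast
  qed
  then show ?thesis
    using assms unfolding smooth_atlas_def smooth_manifold_def by blast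
qed

lemma finite_spanning_set_Times:
  assumes "finite A" "span A = (UNIV :: 'a::real_normed_vector set)"
    and "finite B" "span B = (UNIV :: 'b::real_normed_vector set)"
  shows "finite ((\<lambda>a. (a, 0)) ` A \<union> Pair 0 ` B)"
    and "span ((\<lambda>a. (a, 0)) ` A \<union> Pair 0 ` B) = (UNIV :: ('a \<times> 'b) set)"
proof -
  show "finite ((\<lambda>a. (a, 0)) ` A \<union> Pair 0 ` B)" using assms by simp
  let ?S = "span ((\<lambda>a. (a, 0)) ` A \<union> Pair 0 ` B) :: ('a \<times> 'b) set"
  have l: "linear (\<lambda>a::'a. (a, 0::'b))" "linear (Pair (0::'a) :: 'b \<Rightarrow> _)"
    by (auto intro!: linearI)
  have "(\<lambda>a. (a, 0)) ` span A \<subseteq> ?S" "Pair 0 ` span B \<subseteq> ?S"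
    unfolding linear_span_image[OF l(1), symmetric] linear_span_image[OF l(2), symmetric]
    by (auto intro!: span_mono)
  then have "(a, 0) \<in> ?S" "(0, b) \<in> ?S" for a b
    using assms by auto
  then have "(a, 0) + (0, b) \<in> ?S" for a b
    by (intro span_add)
  then show "?S = UNIV" by auto
qed

lemma prod_manifold_simps [simp]:
  "mtop (prod_manifold Y M) = prod_topology (mtop Y) (mtop M)"
  "idx (prod_manifold Y M) = idx Y \<times> idx M"
  "cdom (prod_manifold Y M) (i, k) = cdom Y i \<times> cdom M k"
  "chart (prod_manifold Y M) (i, k) = map_prod (chart Y i) (chart M k)"
  "acs (prod_manifold Y M) (i, k) (x, z) (u, v) = (acs Y i x u, acs M k z v)"
  by (simp_all add: prod_manifold_def)

lemma smooth_atlas_prod_manifold: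
  fixes Y :: "('y, 'i, 'e::real_normed_vector) ac_manifold"
    and M :: "('m, 'k, 'g::real_normed_vector) ac_manifold"
  assumes Y: "smooth_atlas Y" and M: "smooth_atlas M"
  shows "smooth_atlas (prod_manifold Y M)"
  unfolding smooth_atlas_def
proof (intro conjI ballI allI impI)
  show "\<exists>B::('e \<times> 'g) set. finite B \<and> span B = UNIV"
    using assms unfolding smooth_atlas_def by (metis finite_spanning_set_Times)
  show "topspace (mtop (prod_manifold Y M)) = (\<Union>i\<in>idx (prod_manifold Y M). cdom (prod_manifold Y M) i)"
    using assms by (auto simp: smooth_atlas_def)
  fix p assume "p \<in> idx (prod_manifold Y M)"
  then obtain i k where p: "p = (i, k)" "i \<in> idx Y" "k \<in> idx M" by auto
  show "openin (mtop (prod_manifold Y M)) (cdom (prod_manifold Y M) p)"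
    using assms p by (auto simp: smooth_atlas_def openin_prod_Times_iff)
  show "inj_on (chart (prod_manifold Y M) p) (cdom (prod_manifold Y M) p)"
    using assms p by (auto simp: smooth_atlas_def intro!: map_prod_inj_on)
  fix W assume W: "W \<subseteq> cdom (prod_manifold Y M) p" "openin (mtop (prod_manifold Y M)) W"
  show "open (chart (prod_manifold Y M) p ` W)"
  proof (subst open_prod_def, intro ballI)
    fix q assume "q \<in> chart (prod_manifold Y M) p ` W"
    then obtain y z where yz: "(y, z) \<in> W" "q = (chart Y i y, chart M k z)"
      using p by auto
    then obtain U V where UV: "openin (mtop Y) U" "openin (mtop M) V" "y \<in> U" "z \<in> V" "U \<times> V \<subseteq> W"
      using W(2) by (force simp: openin_prod_topology_alt)
    then have "U \<subseteq> cdom Y i" "V \<subseteq> cdom M k"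
      using W(1) p by auto
    then have "open (chart Y i ` U)" "open (chart M k ` V)"
      using assms UV p by (auto simp: smooth_atlas_def)
    moreover have "chart Y i ` U \<times> chart M k ` V \<subseteq> chart (prod_manifold Y M) p ` W"
      using UV(5) p by force
    ultimately show "\<exists>A B. open A \<and> open B \<and> q \<in> A \<times> B \<and> A \<times> B \<subseteq> chart (prod_manifold Y M) p ` W"
      using yz UV by blast
  qed
qed

text \<open>Stated with the charts of \<open>Y\<close> itself, so that passing to a smaller open set
  leaves the manifold record unchanged. Agreement with \<open>open_submanifold\<close> is shown in
  \<open>pseudoholomorphic_open_submanifold\<close>.\<close>

definition pseudoholomorphic_on ::
  "('a, 'i, 'e::real_normed_vector) ac_manifold \<Rightarrow> ('b, 'j, 'f::real_normed_vector) ac_manifold \<Rightarrow>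
   'a set \<Rightarrow> ('a \<Rightarrow> 'b) \<Rightarrow> bool" where
  "pseudoholomorphic_on Y X U f \<longleftrightarrow>
     continuous_map (subtopology (mtop Y) U) (mtop X) f \<and>
     (\<forall>i\<in>idx Y. \<forall>j\<in>idx X.
        smooth_on (chart Y i ` {y \<in> cdom Y i \<inter> U. f y \<in> cdom X j}) (local_rep Y X f i j) \<and>
        (\<forall>y\<in>cdom Y i \<inter> U. f y \<in> cdom X j \<longrightarrow>
          (\<forall>v. frechet_derivative (local_rep Y X f i j) (at (chart Y i y)) (acs Y i (chart Y i y) v) =
             acs X j (chart X j (f y)) (frechet_derivative (local_rep Y X f i j) (at (chart Y i y)) v))))"

lemma pseudoholomorphic_on_topspace:
  assumes "smooth_atlas Y"
  shows "pseudoholomorphic_on Y X (topspace (mtop Y)) f \<longleftrightarrow> pseudoholomorphic Y X f"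
proof -
  have "cdom Y i \<inter> topspace (mtop Y) = cdom Y i" if "i \<in> idx Y" for i
    using assms that by (auto simp: smooth_atlas_def)
  then show ?thesis
    by (auto simp: pseudoholomorphic_on_def pseudoholomorphic_def smooth_map_def Let_def)
qed

lemma param_chart:
  assumes "smooth_atlas Y" "i \<in> idx Y" "y \<in> cdom Y i"
  shows "param Y i (chart Y i y) = y"
  using assms by (auto simp: param_def smooth_atlas_def)

text \<open>Congruence of \<open>smooth_on\<close> and transfer of derivatives need an open domain;
  this provides it for local representatives of continuous maps.\<close>

lemma open_chart_image:
  assumes "smooth_atlas Y" "smooth_atlas X" "openin (mtop Y) U"
    and "continuous_map (subtopology (mtop Y) U) (mtop X) f" "i \<in> idx Y" "j \<in> idx X"
  shows "open (chart Y i ` {y \<in> cdom Y i \<inter> U. f y \<in> cdom X j})"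
proof -
  have "openin (subtopology (mtop Y) U) {y \<in> topspace (subtopology (mtop Y) U). f y \<in> cdom X j}"
    using assms by (intro openin_continuous_map_preimage[where Y = "mtop X"]) (auto simp: smooth_atlas_def)
  then have "openin (mtop Y) {y \<in> topspace (subtopology (mtop Y) U). f y \<in> cdom X j}"
    using assms(3) openin_trans_full by blast
  then have "openin (mtop Y) (cdom Y i \<inter> {y \<in> topspace (subtopology (mtop Y) U). f y \<in> cdom X j})"
    using assms by (intro openin_Int) (auto simp: smooth_atlas_def)
  also have "cdom Y i \<inter> {y \<in> topspace (subtopology (mtop Y) U). f y \<in> cdom X j} =
      {y \<in> cdom Y i \<inter> U. f y \<in> cdom X j}"
    using assms(1,5) by (auto simp: smooth_atlas_def)
  finally show ?thesis
    using assms by (auto simp: smooth_atlas_def)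
qed

lemma smooth_on_cong:
  assumes "smooth_on S f" "open S" "\<And>x. x \<in> S \<Longrightarrow> f x = g x"
  shows "smooth_on S g"
  using assms Ck_on_cong unfolding smooth_on_def by blast

lemma smooth_on_imp_differentiable: "smooth_on S f \<Longrightarrow> x \<in> S \<Longrightarrow> f differentiable at x"
  unfolding smooth_on_def by (meson Ck_on.simps(2))

text \<open>\<open>local_rep\<close> passes through \<open>inv_into\<close> and is arbitrary away
  from the chart image. Smoothness and derivatives being local, it may be replaced near each point
  by any smooth \<open>F\<close> with the same values where the representative is
  meaningful.\<close>

lemma pseudoholomorphic_onI:
  assumes "smooth_atlas Y" "smooth_atlas X" "openin (mtop Y) U"
    and "continuous_map (subtopology (mtop Y) U) (mtop X) f"
    and "\<And>i j y. i \<in> idx Y \<Longrightarrow> j \<in> idx X \<Longrightarrow> y \<in> cdom Y i \<Longrightarrow> y \<in> U \<Longrightarrow> f y \<in> cdom X j \<Longrightarrow>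
      \<exists>S F. open S \<and> chart Y i y \<in> S \<and> smooth_on S F \<and>
        (\<forall>z\<in>cdom Y i \<inter> U. chart Y i z \<in> S \<longrightarrow> f z \<in> cdom X j \<longrightarrow> F (chart Y i z) = chart X j (f z)) \<and>
        (\<forall>v. frechet_derivative F (at (chart Y i y)) (acs Y i (chart Y i y) v) =
           acs X j (chart X j (f y)) (frechet_derivative F (at (chart Y i y)) v))"
  shows "pseudoholomorphic_on Y X U f"
  unfolding pseudoholomorphic_on_def
proof (intro conjI ballI)
  fix i j assume ij: "i \<in> idx Y" "j \<in> idx X"
  let ?S = "chart Y i ` {y \<in> cdom Y i \<inter> U. f y \<in> cdom X j}"
  let ?L = "local_rep Y X f i j"
  have *: "\<exists>T. open T \<and> chart Y i y \<in> T \<and> smooth_on T ?L \<and>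
      (\<forall>v. frechet_derivative ?L (at (chart Y i y)) (acs Y i (chart Y i y) v) =
           acs X j (chart X j (f y)) (frechet_derivative ?L (at (chart Y i y)) v))"
    if y: "y \<in> cdom Y i" "y \<in> U" "f y \<in> cdom X j" for y
  proof -
    obtain S F where S: "open S" "chart Y i y \<in> S" "smooth_on S F"
        "\<And>z. z \<in> cdom Y i \<Longrightarrow> z \<in> U \<Longrightarrow> chart Y i z \<in> S \<Longrightarrow> f z \<in> cdom X j \<Longrightarrow> F (chart Y i z) = chart X j (f z)"
        "\<And>v. frechet_derivative F (at (chart Y i y)) (acs Y i (chart Y i y) v) =
           acs X j (chart X j (f y)) (frechet_derivative F (at (chart Y i y)) v)"
      using assms(5)[OF ij y] by blast
    \<comment> \<open>\<open>F\<close> and the local representative are known to agree only over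
      \<open>?S\<close>, hence the intersection.\<close>
    have o: "open (S \<inter> ?S)" "chart Y i y \<in> S \<inter> ?S"
      using S(1,2) open_chart_image[OF assms(1-4) ij] y by auto
    have eq: "F x = ?L x" if "x \<in> S \<inter> ?S" for x
      using that S(4) param_chart[OF assms(1) ij(1)] by (auto simp: local_rep_def)
    have sF: "smooth_on (S \<inter> ?S) F"
      using S(3) Ck_on_subset unfolding smooth_on_def by blast
    have "smooth_on (S \<inter> ?S) ?L"
      by (rule smooth_on_cong[OF sF o(1) eq])
    moreover have "frechet_derivative ?L (at (chart Y i y)) = frechet_derivative F (at (chart Y i y))"
      by (rule frechet_derivative_transform_open(2)[OF smooth_on_imp_differentiable[OF S(3,2)] o eq])
    ultimately show ?thesis
      using o S(5) by (intro exI[of _ "S \<inter> ?S"]) simp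
  qed
  show "smooth_on ?S ?L"
    unfolding smooth_on_def
  proof (intro allI Ck_on_local)
    fix k x assume "x \<in> ?S"
    then show "\<exists>T. open T \<and> x \<in> T \<and> Ck_on k T ?L"
      using * unfolding smooth_on_def by blast
  qed
  show "f y \<in> cdom X j \<longrightarrow>
      (\<forall>v. frechet_derivative ?L (at (chart Y i y)) (acs Y i (chart Y i y) v) =
         acs X j (chart X j (f y)) (frechet_derivative ?L (at (chart Y i y)) v))"
    if "y \<in> cdom Y i \<inter> U" for y
    using that * by blast
qed (use assms(4) in auto)

text \<open>Covers both shrinking the open set and passing to or from
  \<open>open_submanifold\<close>. The latter alters the chart domains and with them
  \<open>param\<close>, so values are compared only at points of \<open>V\<close>. Allowing
  \<open>g\<close> in place of \<open>f\<close> accommodates \<open>restrict\<close>.\<close>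

lemma pseudoholomorphic_on_same_charts:
  assumes "smooth_atlas Y" "smooth_atlas Z" "smooth_atlas X" "openin (mtop Z) V"
    and charts: "idx Z = idx Y" "chart Z = chart Y" "acs Z = acs Y" "\<And>i. cdom Z i \<inter> V \<subseteq> cdom Y i \<inter> U"
    and f: "pseudoholomorphic_on Y X U f" and eq: "\<And>y. y \<in> V \<Longrightarrow> f y = g y"
    and cont: "continuous_map (subtopology (mtop Z) V) (mtop X) g"
  shows "pseudoholomorphic_on Z X V g"
proof (rule pseudoholomorphic_onI[OF assms(2-4) cont])
  fix i j y assume ij: "i \<in> idx Z" "j \<in> idx X" and y: "y \<in> cdom Z i" "y \<in> V" "g y \<in> cdom X j"
  let ?S = "\<lambda>Y U f. chart Y i ` {y \<in> cdom Y i \<inter> U. f y \<in> cdom X j}"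
  have iY: "i \<in> idx Y" using ij charts by simp
  have dom: "z \<in> cdom Y i" "z \<in> U" if "z \<in> cdom Z i" "z \<in> V" for z
    using charts(4)[of i] that by auto
  show "\<exists>S F. open S \<and> chart Z i y \<in> S \<and> smooth_on S F \<and>
        (\<forall>z\<in>cdom Z i \<inter> V. chart Z i z \<in> S \<longrightarrow> g z \<in> cdom X j \<longrightarrow> F (chart Z i z) = chart X j (g z)) \<and>
        (\<forall>v. frechet_derivative F (at (chart Z i y)) (acs Z i (chart Z i y) v) =
           acs X j (chart X j (g y)) (frechet_derivative F (at (chart Z i y)) v))"
  proof (intro exI conjI)
    show "open (?S Z V g)"
      by (rule open_chart_image[OF assms(2-4) cont ij])
    have "smooth_on (?S Y U f) (local_rep Y X f i j)"
      using f ij iY unfolding pseudoholomorphic_on_def by blast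
    moreover have "?S Z V g \<subseteq> ?S Y U f"
      using dom eq by (auto simp: charts(2))
    ultimately show "smooth_on (?S Z V g) (local_rep Y X f i j)"
      unfolding smooth_on_def by (blast intro: Ck_on_subset)
    show "chart Z i y \<in> ?S Z V g" using y by blast
    show "\<forall>z\<in>cdom Z i \<inter> V. chart Z i z \<in> ?S Z V g \<longrightarrow> g z \<in> cdom X j \<longrightarrow>
        local_rep Y X f i j (chart Z i z) = chart X j (g z)"
      using dom eq param_chart[OF assms(1) iY] by (simp add: local_rep_def charts(2))
    show "\<forall>v. frechet_derivative (local_rep Y X f i j) (at (chart Z i y)) (acs Z i (chart Z i y) v) =
           acs X j (chart X j (g y)) (frechet_derivative (local_rep Y X f i j) (at (chart Z i y)) v)"
      using f ij(2) iY dom[OF y(1,2)] y(3) eq[OF y(2)] unfolding pseudoholomorphic_on_def charts(2,3)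
      by simp
  qed
qed

lemma pseudoholomorphic_on_cong_subset:
  assumes "smooth_atlas Y" "smooth_atlas X" "openin (mtop Y) V" "V \<subseteq> U"
    and "pseudoholomorphic_on Y X U f" "\<And>y. y \<in> V \<Longrightarrow> f y = g y"
  shows "pseudoholomorphic_on Y X V g"
proof (rule pseudoholomorphic_on_same_charts[OF assms(1,1,2,3) refl refl refl _ assms(5,6)])
  show "cdom Y i \<inter> V \<subseteq> cdom Y i \<inter> U" for i using assms(4) by blast
  have "continuous_map (subtopology (mtop Y) V) (mtop X) f"
    using assms(4,5) continuous_map_from_subtopology_mono unfolding pseudoholomorphic_on_def by blast
  then show "continuous_map (subtopology (mtop Y) V) (mtop X) g"
    by (rule continuous_map_eq) (use assms(6) in simp)
qed

lemma pseudoholomorphic_open_submanifold: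
  assumes "smooth_atlas Y" "smooth_atlas X" "openin (mtop Y) U"
  shows "pseudoholomorphic (open_submanifold Y U) X f \<longleftrightarrow> pseudoholomorphic_on Y X U f"
proof -
  let ?Y = "open_submanifold Y U"
  have U: "U \<subseteq> topspace (mtop Y)" by (rule openin_subset[OF assms(3)])
  have sub: "mtop ?Y = subtopology (mtop Y) U" "topspace (mtop ?Y) = U"
      "subtopology (mtop ?Y) U = subtopology (mtop Y) U"
    using U by (auto simp: open_submanifold_def subtopology_subtopology)
  have charts: "idx ?Y = idx Y" "chart ?Y = chart Y" "acs ?Y = acs Y" "cdom ?Y i = cdom Y i \<inter> U" for i
    by (simp_all add: open_submanifold_def)
  have op: "openin (mtop ?Y) W \<longleftrightarrow> openin (mtop Y) W \<and> W \<subseteq> U" for W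
    unfolding sub(1) by (rule openin_open_subtopology[OF assms(3)])
  have at: "smooth_atlas ?Y"
    using assms(1,3) U unfolding smooth_atlas_def charts sub(2) op
    by (auto intro: inj_on_subset)
  show ?thesis
    unfolding pseudoholomorphic_on_topspace[OF at, symmetric] sub(2)
  proof
    assume f: "pseudoholomorphic_on ?Y X U f"
    show "pseudoholomorphic_on Y X U f"
      by (rule pseudoholomorphic_on_same_charts[OF at assms charts(1-3)[symmetric] _ f refl])
        (use f in \<open>auto simp: pseudoholomorphic_on_def charts sub(3)\<close>)
  next
    assume f: "pseudoholomorphic_on Y X U f"
    have "openin (mtop ?Y) U" using assms(3) by (simp add: op)
    then show "pseudoholomorphic_on ?Y X U f"
      by (rule pseudoholomorphic_on_same_charts[OF assms(1) at assms(2) _ charts(1-3) _ f refl])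
        (use f in \<open>auto simp: pseudoholomorphic_on_def charts sub(3)\<close>)
  qed
qed

text \<open>The chain rule is applied through a chart \<open>k\<close> of \<open>Z\<close> at
  \<open>h y\<close>; both derivatives intertwine the complex structures, hence so does their
  composite.\<close>

lemma pseudoholomorphic_on_compose:
  fixes Z :: "('z, 'k, 'g::real_normed_vector) ac_manifold"
  assumes Y: "smooth_atlas Y" and Z: "smooth_atlas Z" and X: "smooth_atlas X" and U: "openin (mtop Y) U"
    and h: "pseudoholomorphic_on Y Z U h" and f: "pseudoholomorphic_on Z X V f" and "openin (mtop Z) V"
  shows "pseudoholomorphic_on Y X {y \<in> U. h y \<in> V} (f \<circ> h)"
proof -
  let ?W = "{y \<in> U. h y \<in> V}"
  have top: "topspace (subtopology (mtop Y) U) = U"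
    using openin_subset[OF U] by auto
  have hcont: "continuous_map (subtopology (mtop Y) U) (mtop Z) h"
    using h by (simp add: pseudoholomorphic_on_def)
  have "openin (subtopology (mtop Y) U) ?W"
    using openin_continuous_map_preimage[OF hcont assms(7)] by (simp only: top)
  then have W: "openin (mtop Y) ?W"
    using openin_open_subtopology[OF U] by blast
  have "continuous_map (subtopology (mtop Y) ?W) (subtopology (mtop Z) V) h"
    using continuous_map_from_subtopology_mono[OF hcont, of ?W]
    by (auto simp: continuous_map_in_subtopology)
  then have cont: "continuous_map (subtopology (mtop Y) ?W) (mtop X) (f \<circ> h)"
    using f continuous_map_compose by (fastforce simp: pseudoholomorphic_on_def)
  show ?thesis
  proof (rule pseudoholomorphic_onI[OF Y X W cont])
    fix i j y assume ij: "i \<in> idx Y" "j \<in> idx X"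
      and y: "y \<in> cdom Y i" "y \<in> ?W" "(f \<circ> h) y \<in> cdom X j"
    have "h y \<in> topspace (mtop Z)"
      using y(2) openin_subset[OF assms(7)] by blast
    then obtain k where k: "k \<in> idx Z" "h y \<in> cdom Z k"
      using Z by (auto simp: smooth_atlas_def)
    let ?h = "local_rep Y Z h i k" and ?f = "local_rep Z X f k j"
    let ?T = "chart Z k ` {z \<in> cdom Z k \<inter> V. f z \<in> cdom X j}"
    let ?S' = "chart Y i ` {y \<in> cdom Y i \<inter> ?W. (f \<circ> h) y \<in> cdom X j}"
    let ?S'' = "chart Y i ` {y \<in> cdom Y i \<inter> U. h y \<in> cdom Z k}"
    let ?S = "chart Y i ` {y \<in> cdom Y i. y \<in> U \<and> h y \<in> cdom Z k \<and> h y \<in> V \<and> f (h y) \<in> cdom X j}"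
    have inj: "inj_on (chart Y i) (cdom Y i)"
      using Y ij by (simp add: smooth_atlas_def)
    \<comment> \<open>Near \<open>y\<close> the map \<open>h\<close> also has to stay in the chart
      \<open>k\<close>. Injectivity of the chart of \<open>Y\<close> expresses this as an
      intersection of two sets known to be open.\<close>
    have "?S = ?S' \<inter> ?S''"
      by (subst inj_on_image_Int[OF inj, symmetric]) auto
    moreover have "open ?S'" "open ?S''"
      by (rule open_chart_image[OF Y X W cont ij]) (rule open_chart_image[OF Y Z U hcont ij(1) k(1)])
    ultimately have S: "open ?S" by (simp only: open_Int)
    have hs: "smooth_on ?S ?h"
      using h ij(1) k(1) unfolding pseudoholomorphic_on_def smooth_on_def
      by (auto intro: Ck_on_subset)
    have fs: "smooth_on ?T ?f"
      using f ij(2) k(1) unfolding pseudoholomorphic_on_def by blast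
    have hval: "?h (chart Y i y') = chart Z k (h y')" if "y' \<in> cdom Y i" for y'
      using param_chart[OF Y ij(1) that] by (simp add: local_rep_def)
    have fval: "?f (chart Z k z) = chart X j (f z)" if "z \<in> cdom Z k" for z
      using param_chart[OF Z k(1) that] by (simp add: local_rep_def)
    have hST: "?h ` ?S \<subseteq> ?T"
      using hval by auto
    obtain B :: "'g set" where "finite B" "span B = UNIV"
      using Z unfolding smooth_atlas_def by blast
    then have comp: "smooth_on ?S (\<lambda>x. ?f (?h x))"
      using Ck_on_compose[OF _ _ S _ _ hST] hs fs unfolding smooth_on_def by blast
    have yS: "chart Y i y \<in> ?S" using y k by auto
    let ?Dh = "frechet_derivative ?h (at (chart Y i y))"
    let ?Df = "frechet_derivative ?f (at (chart Z k (h y)))"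
    have "chart Z k (h y) \<in> ?T"
      using y k by auto
    then have "((\<lambda>x. ?f (?h x)) has_derivative (\<lambda>v. ?Df (?Dh v))) (at (chart Y i y))"
      using diff_chain_at[of ?h ?Dh "chart Y i y" ?f ?Df] hval[OF y(1)]
        smooth_on_imp_differentiable[OF hs yS] smooth_on_imp_differentiable[OF fs]
      by (simp add: frechet_derivative_works o_def)
    then have D: "frechet_derivative (\<lambda>x. ?f (?h x)) (at (chart Y i y)) = (\<lambda>v. ?Df (?Dh v))"
      by (rule frechet_derivative_eq)
    have J: "?Dh (acs Y i (chart Y i y) v) = acs Z k (chart Z k (h y)) (?Dh v)" for v
      using h ij(1) k y by (auto simp: pseudoholomorphic_on_def)
    have J': "?Df (acs Z k (chart Z k (h y)) v) = acs X j (chart X j (f (h y))) (?Df v)" for v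
      using f ij(2) k y by (auto simp: pseudoholomorphic_on_def)
    show "\<exists>S F. open S \<and> chart Y i y \<in> S \<and> smooth_on S F \<and>
        (\<forall>z\<in>cdom Y i \<inter> ?W. chart Y i z \<in> S \<longrightarrow> (f \<circ> h) z \<in> cdom X j \<longrightarrow>
           F (chart Y i z) = chart X j ((f \<circ> h) z)) \<and>
        (\<forall>v. frechet_derivative F (at (chart Y i y)) (acs Y i (chart Y i y) v) =
           acs X j (chart X j ((f \<circ> h) y)) (frechet_derivative F (at (chart Y i y)) v))"
    proof (intro exI conjI ballI impI)
      fix z assume z: "z \<in> cdom Y i \<inter> ?W" "chart Y i z \<in> ?S"
      \<comment> \<open>\<open>z\<close> itself satisfies the conditions defining \<open>?S\<close>,
        because its coordinates determine it.\<close>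
      then have "h z \<in> cdom Z k"
        using inj by (auto simp: inj_on_def)
      then show "?f (?h (chart Y i z)) = chart X j ((f \<circ> h) z)"
        using z hval fval by auto
    qed (use S yS comp in \<open>auto simp: D J J'\<close>)
  qed
qed

section \<open>Composites, identity, constants, projections and pairings\<close>

lemma pseudoholomorphic_compose:
  assumes "smooth_atlas Y" "smooth_atlas Z" "smooth_atlas X"
    and "pseudoholomorphic Y Z h" "pseudoholomorphic Z X f"
  shows "pseudoholomorphic Y X (f \<circ> h)"
proof -
  have "{y \<in> topspace (mtop Y). h y \<in> topspace (mtop Z)} = topspace (mtop Y)"
    using assms(4) by (auto simp: pseudoholomorphic_def smooth_map_def continuous_map_def)
  then show ?thesis
    using pseudoholomorphic_on_compose[OF assms(1-3), of "topspace (mtop Y)" h "topspace (mtop Z)" f] assms(4,5)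
    by (simp add: pseudoholomorphic_on_topspace assms(1,2))
qed

text \<open>Local representatives of the identity are the transition maps, so both requirements are
  compatibility clauses of the atlas and of the almost complex structure.\<close>

lemma pseudoholomorphic_ident:
  assumes "smooth_manifold Y" "almost_complex_structure Y"
  shows "pseudoholomorphic Y Y (\<lambda>y. y)"
proof -
  have at: "smooth_atlas Y" by (rule smooth_atlas_smooth_manifold[OF assms(1)])
  have "{y \<in> cdom Y i. y \<in> cdom Y j} = cdom Y i \<inter> cdom Y j" for i j by blast
  moreover have "transition Y i j (chart Y i y) = chart Y j y" if "i \<in> idx Y" "y \<in> cdom Y i" for i j y
    using param_chart[OF at that] by (simp add: local_rep_def)
  ultimately show ?thesis
    using assms unfolding pseudoholomorphic_def smooth_map_def
    by (auto simp: smooth_manifold_def almost_complex_structure_def Let_def)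
qed

text \<open>The derivative vanishes and \<open>acs\<close> is linear, so the equation to be checked
  reads 0 = 0.\<close>

lemma pseudoholomorphic_const:
  assumes "smooth_atlas Y" "smooth_atlas M" "almost_complex_structure M" "c \<in> topspace (mtop M)"
  shows "pseudoholomorphic Y M (\<lambda>y. c)"
  unfolding pseudoholomorphic_on_topspace[OF assms(1), symmetric]
proof (rule pseudoholomorphic_onI[OF assms(1,2) openin_topspace])
  show "continuous_map (subtopology (mtop Y) (topspace (mtop Y))) (mtop M) (\<lambda>y. c)"
    using assms(4) by simp
  fix i j y assume "j \<in> idx M" "c \<in> cdom M j"
  then have "linear (acs M j (chart M j c))"
    using assms(3) by (auto simp: almost_complex_structure_def)
  then show "\<exists>S F. open S \<and> chart Y i y \<in> S \<and> smooth_on S F \<and>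
        (\<forall>z\<in>cdom Y i \<inter> topspace (mtop Y). chart Y i z \<in> S \<longrightarrow> c \<in> cdom M j \<longrightarrow>
           F (chart Y i z) = chart M j c) \<and>
        (\<forall>v. frechet_derivative F (at (chart Y i y)) (acs Y i (chart Y i y) v) =
           acs M j (chart M j c) (frechet_derivative F (at (chart Y i y)) v))"
    by (intro exI[of _ UNIV] exI[of _ "\<lambda>_. chart M j c"])
      (simp add: smooth_on_def Ck_on_const linear_0)
qed

text \<open>
  Composition with a map that is linear in suitable charts.  Applied to the identity, it makes the
  projections of a product pseudoholomorphic.
\<close>

lemma pseudoholomorphic_comp_chart_linear:
  fixes Z :: "('z, 'k, 'g::real_normed_vector) ac_manifold"
    and Y :: "('y, 'i, 'e::real_normed_vector) ac_manifold"
  assumes "smooth_atlas Z" "smooth_atlas Y" "smooth_atlas X"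
    and f: "pseudoholomorphic Y X f" and h: "continuous_map (mtop Z) (mtop Y) h"
    and L: "bounded_linear L"
    and idx: "\<And>k. k \<in> idx Z \<Longrightarrow> \<phi> k \<in> idx Y"
    and cdom: "\<And>k z. k \<in> idx Z \<Longrightarrow> z \<in> cdom Z k \<Longrightarrow> h z \<in> cdom Y (\<phi> k)"
    and chart: "\<And>k z. k \<in> idx Z \<Longrightarrow> z \<in> cdom Z k \<Longrightarrow> chart Y (\<phi> k) (h z) = L (chart Z k z)"
    and acs: "\<And>k z v. k \<in> idx Z \<Longrightarrow> z \<in> cdom Z k \<Longrightarrow>
      L (acs Z k (chart Z k z) v) = acs Y (\<phi> k) (L (chart Z k z)) (L v)"
  shows "pseudoholomorphic Z X (f \<circ> h)"
  unfolding pseudoholomorphic_on_topspace[OF assms(1), symmetric]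
proof (rule pseudoholomorphic_onI[OF assms(1,3) openin_topspace])
  have "continuous_map (mtop Y) (mtop X) f"
    using f by (simp add: pseudoholomorphic_def smooth_map_def)
  then show cont: "continuous_map (subtopology (mtop Z) (topspace (mtop Z))) (mtop X) (f \<circ> h)"
    unfolding subtopology_topspace by (rule continuous_map_compose[OF h])
  fix k j z assume k: "k \<in> idx Z" and j: "j \<in> idx X" and z: "z \<in> cdom Z k" "(f \<circ> h) z \<in> cdom X j"
  let ?T = "chart Y (\<phi> k) ` {y \<in> cdom Y (\<phi> k). f y \<in> cdom X j}" and ?F = "local_rep Y X f (\<phi> k) j"
  let ?S = "chart Z k ` {z \<in> cdom Z k \<inter> topspace (mtop Z). (f \<circ> h) z \<in> cdom X j}"
  have S: "open ?S"
    by (rule open_chart_image[OF assms(1,3) openin_topspace cont k j])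
  have zS: "chart Z k z \<in> ?S"
    using assms(1) k z by (auto simp: smooth_atlas_def)
  have sm: "smooth_on ?T ?F"
    using f idx[OF k] j by (simp add: pseudoholomorphic_def smooth_map_def)
  have "L (chart Z k z) \<in> ?T"
    using z cdom[OF k] chart[OF k z(1), symmetric] by auto
  note df = smooth_on_imp_differentiable[OF sm this, unfolded frechet_derivative_works]
  have LT: "L ` ?S \<subseteq> ?T"
    using cdom[OF k] chart[OF k, symmetric] by auto
  obtain B :: "'e set" where "finite B" "span B = UNIV"
    using assms(2) unfolding smooth_atlas_def by blast
  then have comp: "smooth_on ?S (\<lambda>x. ?F (L x))"
    using sm Ck_on_compose[OF _ _ S Ck_on_bounded_linear[OF L S] _ LT]
    unfolding smooth_on_def by blast
  have D: "frechet_derivative (\<lambda>x. ?F (L x)) (at (chart Z k z)) =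
      (\<lambda>v. frechet_derivative ?F (at (L (chart Z k z))) (L v))"
    using diff_chain_at[OF bounded_linear_imp_has_derivative[OF L] df]
    by (intro frechet_derivative_eq) (simp add: o_def)
  have J: "frechet_derivative ?F (at (L (chart Z k z))) (acs Y (\<phi> k) (L (chart Z k z)) v) =
      acs X j (chart X j (f (h z))) (frechet_derivative ?F (at (L (chart Z k z))) v)" for v
    using f idx[OF k] j cdom[OF k z(1)] z(2) chart[OF k z(1)]
    by (force simp: pseudoholomorphic_def Let_def)
  show "\<exists>S F. open S \<and> chart Z k z \<in> S \<and> smooth_on S F \<and>
        (\<forall>z\<in>cdom Z k \<inter> topspace (mtop Z). chart Z k z \<in> S \<longrightarrow> (f \<circ> h) z \<in> cdom X j \<longrightarrow>
           F (chart Z k z) = chart X j ((f \<circ> h) z)) \<and>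
        (\<forall>v. frechet_derivative F (at (chart Z k z)) (acs Z k (chart Z k z) v) =
           acs X j (chart X j ((f \<circ> h) z)) (frechet_derivative F (at (chart Z k z)) v))"
  proof (intro exI conjI ballI impI allI)
    fix w assume "w \<in> cdom Z k \<inter> topspace (mtop Z)"
    then have w: "w \<in> cdom Z k" by blast
    then show "?F (L (chart Z k w)) = chart X j ((f \<circ> h) w)"
      using param_chart[OF assms(2) idx[OF k] cdom[OF k w]] chart[OF k w, symmetric]
      by (simp add: local_rep_def)
  next
    fix v
    show "frechet_derivative (\<lambda>x. ?F (L x)) (at (chart Z k z)) (acs Z k (chart Z k z) v) =
        acs X j (chart X j ((f \<circ> h) z)) (frechet_derivative (\<lambda>x. ?F (L x)) (at (chart Z k z)) v)"
      unfolding D acs[OF k z(1)] J o_apply ..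
  qed (use S zS comp in blast)+
qed

lemma pseudoholomorphic_fst:
  assumes "smooth_manifold Y" "almost_complex_structure Y" "smooth_manifold M"
  shows "pseudoholomorphic (prod_manifold Y M) Y fst"
proof -
  note at = assms(1,3)[THEN smooth_atlas_smooth_manifold]
  have "pseudoholomorphic (prod_manifold Y M) Y ((\<lambda>y. y) \<circ> fst)"
    by (rule pseudoholomorphic_comp_chart_linear[OF smooth_atlas_prod_manifold[OF at] at(1) at(1)
          pseudoholomorphic_ident[OF assms(1,2)], where \<phi> = fst and L = fst])
      (auto intro: bounded_linear_fst continuous_map_fst)
  then show ?thesis by (simp add: o_def)
qed

lemma pseudoholomorphic_snd:
  assumes "smooth_manifold Y" "smooth_manifold M" "almost_complex_structure M"
  shows "pseudoholomorphic (prod_manifold Y M) M snd"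
proof -
  note at = assms(1,2)[THEN smooth_atlas_smooth_manifold]
  have "pseudoholomorphic (prod_manifold Y M) M ((\<lambda>y. y) \<circ> snd)"
    by (rule pseudoholomorphic_comp_chart_linear[OF smooth_atlas_prod_manifold[OF at] at(2) at(2)
          pseudoholomorphic_ident[OF assms(2,3)], where \<phi> = snd and L = snd])
      (auto intro: bounded_linear_snd continuous_map_snd)
  then show ?thesis by (simp add: o_def)
qed

text \<open>In a product chart the representative is the pair of the two local representatives, on
  the intersection of their domains, and the product \<open>acs\<close> acts componentwise.\<close>

lemma pseudoholomorphic_Pair:
  assumes "smooth_atlas Z" "smooth_atlas Y" "smooth_atlas M"
    and f: "pseudoholomorphic Z Y f" and g: "pseudoholomorphic Z M g"
  shows "pseudoholomorphic Z (prod_manifold Y M) (\<lambda>z. (f z, g z))"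
  unfolding pseudoholomorphic_on_topspace[OF assms(1), symmetric]
proof (rule pseudoholomorphic_onI[OF assms(1) smooth_atlas_prod_manifold[OF assms(2,3)] openin_topspace])
  have cont: "continuous_map (mtop Z) (mtop Y) f" "continuous_map (mtop Z) (mtop M) g"
    using f g by (simp_all add: pseudoholomorphic_def smooth_map_def)
  then show "continuous_map (subtopology (mtop Z) (topspace (mtop Z))) (mtop (prod_manifold Y M)) (\<lambda>z. (f z, g z))"
    by (simp add: continuous_map_paired)
  fix i p z assume i: "i \<in> idx Z" and "p \<in> idx (prod_manifold Y M)"
    and z: "z \<in> cdom Z i" "(f z, g z) \<in> cdom (prod_manifold Y M) p"
  then obtain j k where p: "p = (j, k)" "j \<in> idx Y" "k \<in> idx M" and fz: "f z \<in> cdom Y j" "g z \<in> cdom M k"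
    by (auto simp del: prod_manifold_simps simp: prod_manifold_def)
  let ?Sf = "chart Z i ` {z \<in> cdom Z i. f z \<in> cdom Y j}" and ?F = "local_rep Z Y f i j"
  let ?Sg = "chart Z i ` {z \<in> cdom Z i. g z \<in> cdom M k}" and ?G = "local_rep Z M g i k"
  have sub: "cdom Z i \<inter> topspace (mtop Z) = cdom Z i"
    using assms(1) i by (auto simp: smooth_atlas_def)
  have S: "open (?Sf \<inter> ?Sg)"
    using open_chart_image[OF assms(1,2) openin_topspace, of f i j] cont i p sub
      open_chart_image[OF assms(1,3) openin_topspace, of g i k] by auto
  have zS: "chart Z i z \<in> ?Sf \<inter> ?Sg"
    using z fz by blast
  have sm: "smooth_on (?Sf \<inter> ?Sg) ?F" "smooth_on (?Sf \<inter> ?Sg) ?G"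
    using f g i p unfolding pseudoholomorphic_def smooth_map_def smooth_on_def
    by (blast intro: Ck_on_subset)+
  have D: "frechet_derivative (\<lambda>x. (?F x, ?G x)) (at (chart Z i z)) =
      (\<lambda>v. (frechet_derivative ?F (at (chart Z i z)) v, frechet_derivative ?G (at (chart Z i z)) v))"
    by (intro frechet_derivative_eq has_derivative_Pair
        smooth_on_imp_differentiable[OF sm(1) zS, unfolded frechet_derivative_works]
        smooth_on_imp_differentiable[OF sm(2) zS, unfolded frechet_derivative_works])
  have sP: "smooth_on (?Sf \<inter> ?Sg) (\<lambda>x. (?F x, ?G x))"
    using sm S unfolding smooth_on_def by (blast intro: Ck_on_Pair)
  show "\<exists>S F. open S \<and> chart Z i z \<in> S \<and> smooth_on S F \<and>
        (\<forall>z\<in>cdom Z i \<inter> topspace (mtop Z). chart Z i z \<in> S \<longrightarrow> (f z, g z) \<in> cdom (prod_manifold Y M) p \<longrightarrow>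
           F (chart Z i z) = chart (prod_manifold Y M) p (f z, g z)) \<and>
        (\<forall>v. frechet_derivative F (at (chart Z i z)) (acs Z i (chart Z i z) v) =
           acs (prod_manifold Y M) p (chart (prod_manifold Y M) p (f z, g z))
             (frechet_derivative F (at (chart Z i z)) v))"
  proof (intro exI conjI)
    show "\<forall>v. frechet_derivative (\<lambda>x. (?F x, ?G x)) (at (chart Z i z)) (acs Z i (chart Z i z) v) =
           acs (prod_manifold Y M) p (chart (prod_manifold Y M) p (f z, g z))
             (frechet_derivative (\<lambda>x. (?F x, ?G x)) (at (chart Z i z)) v)"
      using f g i p z fz unfolding D by (simp add: pseudoholomorphic_def Let_def)
  qed (use S zS sP param_chart[OF assms(1) i] p in \<open>auto simp: local_rep_def\<close>)
qed

section \<open>Sections of a sheafification as functions\<close>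

text \<open>
  A presheaf whose sections are determined by their values at points.  Over the empty set nothing is
  required, because the coproduct presheaf has several sections there.
\<close>

definition valued_presheaf :: "'a topology \<Rightarrow> ('a, 's) presheaf \<Rightarrow> ('s \<Rightarrow> 'a \<Rightarrow> 'r) \<Rightarrow> bool" where
  "valued_presheaf T P v \<longleftrightarrow>
     (\<forall>U V s. openin T U \<and> openin T V \<and> V \<subseteq> U \<and> s \<in> sect P U \<longrightarrow>
        res P U V s \<in> sect P V \<and> (\<forall>x\<in>V. v (res P U V s) x = v s x)) \<and>
     (\<forall>U s t. openin T U \<and> U \<noteq> {} \<and> s \<in> sect P U \<and> t \<in> sect P U \<and> (\<forall>x\<in>U. v s x = v t x) \<longrightarrow> s = t)"

lemma valued_presheaf_res:
  assumes "valued_presheaf T P v" "openin T U" "openin T V" "V \<subseteq> U" "s \<in> sect P U"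
  shows "res P U V s \<in> sect P V" "x \<in> V \<Longrightarrow> v (res P U V s) x = v s x"
  using assms(1)[unfolded valued_presheaf_def, THEN conjunct1, rule_format, of U V s] assms(2-) by simp_all

lemma valued_presheaf_eqI:
  assumes "valued_presheaf T P v" "openin T U" "x \<in> U" "s \<in> sect P U" "t \<in> sect P U"
    "\<And>x. x \<in> U \<Longrightarrow> v s x = v t x"
  shows "s = t"
proof -
  have "U \<noteq> {}" using assms(3) by blast
  with assms(2,4-6) show ?thesis
    by (intro assms(1)[unfolded valued_presheaf_def, THEN conjunct2, rule_format, of U s t]) simp
qed

lemma mem_germ_self:
  "openin T V \<Longrightarrow> x \<in> V \<Longrightarrow> t \<in> sect P V \<Longrightarrow> (V, t) \<in> germ T P x V t"
  unfolding germ_def by blast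

text \<open>Equality of restrictions to \<open>W\<close> is equality of values on \<open>W\<close>;
  the point \<open>x\<close> makes \<open>W\<close> nonempty, as \<open>valued_presheaf\<close>
  demands for this conclusion.\<close>

lemma mem_germ_iff:
  assumes "valued_presheaf T P v" "openin T U" "s \<in> sect P U" "x \<in> U"
  shows "(V, t) \<in> germ T P x U s \<longleftrightarrow> openin T V \<and> x \<in> V \<and> t \<in> sect P V \<and>
    (\<exists>W. openin T W \<and> x \<in> W \<and> W \<subseteq> U \<inter> V \<and> (\<forall>y\<in>W. v s y = v t y))"
proof -
  have "res P U W s = res P V W t \<longleftrightarrow> (\<forall>y\<in>W. v s y = v t y)"
    if "openin T V" "t \<in> sect P V" "openin T W" "x \<in> W" "W \<subseteq> U \<inter> V" for W
  proof -
    have W: "W \<subseteq> U" "W \<subseteq> V" using that by auto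
    note U = valued_presheaf_res[OF assms(1,2) that(3) W(1) assms(3)]
    note V = valued_presheaf_res[OF assms(1) that(1,3) W(2) that(2)]
    show ?thesis
    proof
      show "\<forall>y\<in>W. v s y = v t y" if "res P U W s = res P V W t"
        using U(2) V(2) that by simp
      show "res P U W s = res P V W t" if "\<forall>y\<in>W. v s y = v t y"
        by (rule valued_presheaf_eqI[OF assms(1) \<open>openin T W\<close> \<open>x \<in> W\<close> U(1) V(1)]) (simp add: U(2) V(2) that)
    qed
  qed
  then have "(\<exists>W. openin T W \<and> x \<in> W \<and> W \<subseteq> U \<inter> V \<and> res P U W s = res P V W t) \<longleftrightarrow>
      (\<exists>W. openin T W \<and> x \<in> W \<and> W \<subseteq> U \<inter> V \<and> (\<forall>y\<in>W. v s y = v t y))"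
    if "openin T V" "t \<in> sect P V"
    using that by (intro ex_cong1 conj_cong refl)
  then show ?thesis
    by (auto simp: germ_def)
qed

text \<open>A germ contains each of its representatives, in particular \<open>(V, t)\<close>.
  Conversely, agreement near \<open>x\<close> is transitive by intersecting neighbourhoods, so both
  germs have the same members.\<close>

lemma germ_eq_iff:
  assumes "valued_presheaf T P v" "openin T U" "s \<in> sect P U" "x \<in> U" "openin T V" "t \<in> sect P V" "x \<in> V"
  shows "germ T P x U s = germ T P x V t \<longleftrightarrow>
    (\<exists>W. openin T W \<and> x \<in> W \<and> W \<subseteq> U \<inter> V \<and> (\<forall>y\<in>W. v s y = v t y))"
proof
  assume "germ T P x U s = germ T P x V t"
  then have "(V, t) \<in> germ T P x U s"
    using mem_germ_self[OF assms(5,7,6)] by simp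
  then show "\<exists>W. openin T W \<and> x \<in> W \<and> W \<subseteq> U \<inter> V \<and> (\<forall>y\<in>W. v s y = v t y)"
    unfolding mem_germ_iff[OF assms(1-4)] by blast
next
  assume "\<exists>W. openin T W \<and> x \<in> W \<and> W \<subseteq> U \<inter> V \<and> (\<forall>y\<in>W. v s y = v t y)"
  then obtain W where W: "openin T W" "x \<in> W" "W \<subseteq> U \<inter> V" and eq: "\<forall>y\<in>W. v s y = v t y"
    by blast
  have "(\<exists>W. openin T W \<and> x \<in> W \<and> W \<subseteq> U \<inter> V' \<and> (\<forall>y\<in>W. v s y = v t' y)) \<longleftrightarrow>
      (\<exists>W. openin T W \<and> x \<in> W \<and> W \<subseteq> V \<inter> V' \<and> (\<forall>y\<in>W. v t y = v t' y))" for V' t'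
  proof
    assume "\<exists>W. openin T W \<and> x \<in> W \<and> W \<subseteq> U \<inter> V' \<and> (\<forall>y\<in>W. v s y = v t' y)"
    then obtain W' where "openin T W'" "x \<in> W'" "W' \<subseteq> U \<inter> V'" "\<forall>y\<in>W'. v s y = v t' y" by blast
    with W eq show "\<exists>W. openin T W \<and> x \<in> W \<and> W \<subseteq> V \<inter> V' \<and> (\<forall>y\<in>W. v t y = v t' y)"
      by (intro exI[of _ "W \<inter> W'"]) auto
  next
    assume "\<exists>W. openin T W \<and> x \<in> W \<and> W \<subseteq> V \<inter> V' \<and> (\<forall>y\<in>W. v t y = v t' y)"
    then obtain W' where "openin T W'" "x \<in> W'" "W' \<subseteq> V \<inter> V'" "\<forall>y\<in>W'. v t y = v t' y" by blast
    with W eq show "\<exists>W. openin T W \<and> x \<in> W \<and> W \<subseteq> U \<inter> V' \<and> (\<forall>y\<in>W. v s y = v t' y)"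
      by (intro exI[of _ "W \<inter> W'"]) auto
  qed
  then have "(V', t') \<in> germ T P x U s \<longleftrightarrow> (V', t') \<in> germ T P x V t" for V' t'
    unfolding mem_germ_iff[OF assms(1-4)] mem_germ_iff[OF assms(1,5,6,7)] by blast
  then show "germ T P x U s = germ T P x V t" by auto
qed

lemma germ_eqI:
  assumes "valued_presheaf T P v" "openin T U" "s \<in> sect P U" "openin T V" "t \<in> sect P V"
    and "openin T W" "x \<in> W" "W \<subseteq> U" "W \<subseteq> V" "\<And>y. y \<in> W \<Longrightarrow> v s y = v t y"
  shows "germ T P x U s = germ T P x V t"
  using assms(6-10) by (subst germ_eq_iff[OF assms(1-3) _ assms(4,5)]) auto

lemma germ_eqE:
  assumes "valued_presheaf T P v" "openin T U" "s \<in> sect P U" "x \<in> U" "openin T V" "t \<in> sect P V" "x \<in> V"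
    and "germ T P x U s = germ T P x V t"
  obtains W where "openin T W" "x \<in> W" "W \<subseteq> U" "W \<subseteq> V" "\<And>y. y \<in> W \<Longrightarrow> v s y = v t y"
proof -
  obtain W where "openin T W" "x \<in> W" "W \<subseteq> U \<inter> V" "\<forall>y\<in>W. v s y = v t y"
    using germ_eq_iff[OF assms(1-7)] assms(8) by auto
  then show ?thesis by (intro that[of W]) auto
qed

text \<open>A germ is a set of pairs, so a representative can be chosen and evaluated. For a valued
  presheaf all representatives agree near \<open>x\<close>, which makes the choice harmless.\<close>

definition sheafify_val :: "('s \<Rightarrow> 'a \<Rightarrow> 'r) \<Rightarrow> ('a, 's) germs \<Rightarrow> 'a \<Rightarrow> 'r" where
  "sheafify_val v \<sigma> x = v (snd (SOME p. p \<in> \<sigma> x)) x"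

lemma sheafify_val_germ:
  assumes "valued_presheaf T P v" "openin T U" "s \<in> sect P U" "x \<in> U" "\<sigma> x = germ T P x U s"
  shows "sheafify_val v \<sigma> x = v s x"
proof -
  obtain V t where Vt: "(SOME p. p \<in> \<sigma> x) = (V, t)" by fastforce
  have "(U, s) \<in> \<sigma> x" using mem_germ_self[OF assms(2,4,3)] assms(5) by simp
  then have "(V, t) \<in> \<sigma> x" unfolding Vt[symmetric] by (rule someI)
  then have "v s x = v t x"
    unfolding assms(5) mem_germ_iff[OF assms(1-4)] by blast
  with Vt show ?thesis by (simp add: sheafify_val_def)
qed

lemma sect_sheafify_iff:
  "\<sigma> \<in> sect (sheafify T P) U \<longleftrightarrow> \<sigma> \<in> extensional U \<and>
     (\<forall>x\<in>U. \<exists>V s. openin T V \<and> x \<in> V \<and> V \<subseteq> U \<and> s \<in> sect P V \<and> (\<forall>y\<in>V. \<sigma> y = germ T P y V s))"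
  by (simp add: sheafify_def)

lemma sect_sheafifyE:
  assumes "\<sigma> \<in> sect (sheafify T P) U" "x \<in> U"
  obtains V s where "openin T V" "x \<in> V" "V \<subseteq> U" "s \<in> sect P V" "\<And>y. y \<in> V \<Longrightarrow> \<sigma> y = germ T P y V s"
  using assms unfolding sect_sheafify_iff by metis

text \<open>A single value does not determine a germ, but the values on a neighbourhood do, and
  equality is assumed throughout \<open>U\<close>.\<close>

lemma sect_sheafify_eqI:
  assumes "valued_presheaf T P v" "\<sigma> \<in> sect (sheafify T P) U" "\<tau> \<in> sect (sheafify T P) U"
    and "\<And>x. x \<in> U \<Longrightarrow> sheafify_val v \<sigma> x = sheafify_val v \<tau> x"
  shows "\<sigma> = \<tau>"
proof (rule extensionalityI)
  show "\<sigma> \<in> extensional U" "\<tau> \<in> extensional U"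
    using assms by (auto simp: sect_sheafify_iff)
  fix x assume x: "x \<in> U"
  obtain V s where V: "openin T V" "x \<in> V" "V \<subseteq> U" "s \<in> sect P V" "\<And>y. y \<in> V \<Longrightarrow> \<sigma> y = germ T P y V s"
    using sect_sheafifyE[OF assms(2) x] by blast
  obtain W t where W: "openin T W" "x \<in> W" "W \<subseteq> U" "t \<in> sect P W" "\<And>y. y \<in> W \<Longrightarrow> \<tau> y = germ T P y W t"
    using sect_sheafifyE[OF assms(3) x] by blast
  have "v s y = v t y" if "y \<in> V \<inter> W" for y
    using sheafify_val_germ[OF assms(1) V(1,4), of y \<sigma>] sheafify_val_germ[OF assms(1) W(1,4), of y \<tau>]
      V(5)[of y] W(5)[of y] assms(4)[of y] that V(3) by auto
  then have "germ T P x V s = germ T P x W t"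
    using V W by (intro germ_eqI[OF assms(1) V(1,4) W(1,4), of "V \<inter> W"]) auto
  then show "\<sigma> x = \<tau> x" using V W by simp
qed

lemma sect_sheafify_restrict:
  assumes "valued_presheaf T P v" "openin T U" "openin T V" "V \<subseteq> U" "\<sigma> \<in> sect (sheafify T P) U"
  shows "restrict \<sigma> V \<in> sect (sheafify T P) V"
  unfolding sect_sheafify_iff
proof (intro conjI ballI)
  fix x assume x: "x \<in> V"
  obtain W s where W: "openin T W" "x \<in> W" "W \<subseteq> U" "s \<in> sect P W" "\<And>y. y \<in> W \<Longrightarrow> \<sigma> y = germ T P y W s"
    using sect_sheafifyE[OF assms(5), of x] x assms(4) by blast
  have o: "openin T (W \<inter> V)" "W \<inter> V \<subseteq> W" using W assms by auto
  note r = valued_presheaf_res[OF assms(1) W(1) o W(4)]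
  have "restrict \<sigma> V y = germ T P y (W \<inter> V) (res P W (W \<inter> V) s)" if "y \<in> W \<inter> V" for y
    using that W(5)[of y] germ_eqI[OF assms(1) W(1,4) o(1) r(1) o(1) that] r(2) by auto
  then show "\<exists>W s. openin T W \<and> x \<in> W \<and> W \<subseteq> V \<and> s \<in> sect P W \<and> (\<forall>y\<in>W. restrict \<sigma> V y = germ T P y W s)"
    using o r(1) W(2) x by (intro exI[of _ "W \<inter> V"] exI[of _ "res P W (W \<inter> V) s"]) auto
qed simp

text \<open>This lets the same lemmas serve for both sheafifications in the construction of
  \<open>JCor\<close>.\<close>

lemma valued_presheaf_sheafify:
  assumes "valued_presheaf T P v"
  shows "valued_presheaf T (sheafify T P) (sheafify_val v)"
  unfolding valued_presheaf_def
proof (intro conjI allI impI; (elim conjE)?)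
  fix U V \<sigma> assume "openin T U" "openin T V" "V \<subseteq> U" "\<sigma> \<in> sect (sheafify T P) U"
  then have "restrict \<sigma> V \<in> sect (sheafify T P) V"
    by (rule sect_sheafify_restrict[OF assms])
  then show "res (sheafify T P) U V \<sigma> \<in> sect (sheafify T P) V"
    by (simp add: sheafify_def)
  show "\<forall>x\<in>V. sheafify_val v (res (sheafify T P) U V \<sigma>) x = sheafify_val v \<sigma> x"
    by (simp add: sheafify_def sheafify_val_def)
next
  fix U \<sigma> \<tau> assume "\<sigma> \<in> sect (sheafify T P) U" "\<tau> \<in> sect (sheafify T P) U"
    "\<forall>x\<in>U. sheafify_val v \<sigma> x = sheafify_val v \<tau> x"
  then show "\<sigma> = \<tau>"
    by (intro sect_sheafify_eqI[OF assms]) auto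
qed

lemma sect_sheafifyI:
  assumes "openin T U" "s \<in> sect P U" "\<sigma> \<in> extensional U" "\<And>x. x \<in> U \<Longrightarrow> \<sigma> x = germ T P x U s"
  shows "\<sigma> \<in> sect (sheafify T P) U"
  unfolding sect_sheafify_iff using assms by blast

text \<open>Since \<open>b\<close> acts on values by \<open>\<beta>\<close>, arguments that agree
  near a point give results that agree near it. This is the uniqueness behind \<open>THE\<close> in
  the definition.\<close>

lemma sheafify_map2:
  assumes P: "valued_presheaf T P vP" and Q: "valued_presheaf T Q vQ" and R: "valued_presheaf T R vR"
    and b: "\<And>V s t. openin T V \<Longrightarrow> s \<in> sect P V \<Longrightarrow> t \<in> sect Q V \<Longrightarrow> b V s t \<in> sect R V"
    and vb: "\<And>V s t x. openin T V \<Longrightarrow> s \<in> sect P V \<Longrightarrow> t \<in> sect Q V \<Longrightarrow> x \<in> V \<Longrightarrow>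
      vR (b V s t) x = \<beta> (vP s x) (vQ t x)"
    and \<sigma>: "\<sigma> \<in> sect (sheafify T P) U" and \<tau>: "\<tau> \<in> sect (sheafify T Q) U"
  shows "sheafify_map2 T P Q R b U \<sigma> \<tau> \<in> sect (sheafify T R) U"
    and "x \<in> U \<Longrightarrow> sheafify_val vR (sheafify_map2 T P Q R b U \<sigma> \<tau>) x =
      \<beta> (sheafify_val vP \<sigma> x) (sheafify_val vQ \<tau> x)"
proof -
  let ?\<rho> = "sheafify_map2 T P Q R b U \<sigma> \<tau>"
  have germ: "?\<rho> x = germ T R x V (b V s t)"
    if V: "openin T V" "x \<in> V" "V \<subseteq> U" "s \<in> sect P V" "t \<in> sect Q V"
      and st: "\<sigma> x = germ T P x V s" "\<tau> x = germ T Q x V t" for x V s t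
  proof -
    have "germ T R x V' (b V' s' t') = germ T R x V (b V s t)"
      if V': "openin T V'" "x \<in> V'" "s' \<in> sect P V'" "t' \<in> sect Q V'"
        and st': "\<sigma> x = germ T P x V' s'" "\<tau> x = germ T Q x V' t'" for V' s' t'
    proof -
      obtain A where A: "openin T A" "x \<in> A" "A \<subseteq> V'" "A \<subseteq> V" "\<And>y. y \<in> A \<Longrightarrow> vP s' y = vP s y"
        by (rule germ_eqE[OF P V'(1,3,2) V(1,4,2) trans[OF st'(1)[symmetric] st(1)]]) (rule that)
      obtain B where B: "openin T B" "x \<in> B" "B \<subseteq> V'" "B \<subseteq> V" "\<And>y. y \<in> B \<Longrightarrow> vQ t' y = vQ t y"
        by (rule germ_eqE[OF Q V'(1,4,2) V(1,5,2) trans[OF st'(2)[symmetric] st(2)]]) (rule that)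
      show ?thesis
      proof (rule germ_eqI[OF R V'(1) b[OF V'(1,3,4)] V(1) b[OF V(1,4,5)]])
        show "openin T (A \<inter> B)" "x \<in> A \<inter> B" "A \<inter> B \<subseteq> V'" "A \<inter> B \<subseteq> V"
          using A B by auto
        fix y assume y: "y \<in> A \<inter> B"
        then have "y \<in> V'" "y \<in> V" using A(3,4) by auto
        with y show "vR (b V' s' t') y = vR (b V s t) y"
          by (simp add: vb[OF V'(1,3,4)] vb[OF V(1,4,5)] A(5) B(5))
      qed
    qed
    note unique = this
    have "x \<in> U" using V by blast
    then show ?thesis
      unfolding sheafify_map2_def restrict_apply'[OF \<open>x \<in> U\<close>]
    proof (intro the_equality)
      fix g assume "\<exists>V s t. openin T V \<and> x \<in> V \<and> V \<subseteq> U \<and> s \<in> sect P V \<and> t \<in> sect Q V \<and>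
        \<sigma> x = germ T P x V s \<and> \<tau> x = germ T Q x V t \<and> g = germ T R x V (b V s t)"
      then obtain V' s' t' where "openin T V'" "x \<in> V'" "s' \<in> sect P V'" "t' \<in> sect Q V'"
        "\<sigma> x = germ T P x V' s'" "\<tau> x = germ T Q x V' t'" and g: "g = germ T R x V' (b V' s' t')"
        by (elim exE conjE) (rule that)
      then show "g = germ T R x V (b V s t)"
        unfolding g by (intro unique)
    qed (use V st in blast)
  qed
  \<comment> \<open>Local representatives of the two arguments live on different open sets;
    restricting both to the intersection gives a common one.\<close>
  have ex: "\<exists>V s t. openin T V \<and> x \<in> V \<and> V \<subseteq> U \<and> s \<in> sect P V \<and> t \<in> sect Q V \<and>
      (\<forall>y\<in>V. \<sigma> y = germ T P y V s \<and> \<tau> y = germ T Q y V t)" if x: "x \<in> U" for x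
  proof -
    obtain V s where V: "openin T V" "x \<in> V" "V \<subseteq> U" "s \<in> sect P V" "\<And>y. y \<in> V \<Longrightarrow> \<sigma> y = germ T P y V s"
      using sect_sheafifyE[OF \<sigma> x] by blast
    obtain W t where W: "openin T W" "x \<in> W" "W \<subseteq> U" "t \<in> sect Q W" "\<And>y. y \<in> W \<Longrightarrow> \<tau> y = germ T Q y W t"
      using sect_sheafifyE[OF \<tau> x] by blast
    have o: "openin T (V \<inter> W)" "V \<inter> W \<subseteq> V" "V \<inter> W \<subseteq> W" using V W by auto
    note rV = valued_presheaf_res[OF P V(1) o(1,2) V(4)]
    note rW = valued_presheaf_res[OF Q W(1) o(1,3) W(4)]
    have "\<sigma> y = germ T P y (V \<inter> W) (res P V (V \<inter> W) s)" "\<tau> y = germ T Q y (V \<inter> W) (res Q W (V \<inter> W) t)"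
      if "y \<in> V \<inter> W" for y
      using that V(5)[of y] germ_eqI[OF P V(1,4) o(1) rV(1) o(1) that] rV(2)
        W(5)[of y] germ_eqI[OF Q W(1,4) o(1) rW(1) o(1) that] rW(2) by auto
    then show ?thesis
      using o rV(1) rW(1) V(2,3) W(2)
      by (intro exI[of _ "V \<inter> W"] exI[of _ "res P V (V \<inter> W) s"] exI[of _ "res Q W (V \<inter> W) t"]) auto
  qed
  show "?\<rho> \<in> sect (sheafify T R) U"
    unfolding sect_sheafify_iff
  proof (intro conjI ballI)
    show "?\<rho> \<in> extensional U" by (simp add: sheafify_map2_def)
    fix x assume x: "x \<in> U"
    obtain V s t where V: "openin T V" "x \<in> V" "V \<subseteq> U" "s \<in> sect P V" "t \<in> sect Q V"
      and st: "\<forall>y\<in>V. \<sigma> y = germ T P y V s \<and> \<tau> y = germ T Q y V t" using ex[OF x] by (elim exE conjE) (rule that)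
    have "?\<rho> y = germ T R y V (b V s t)" if "y \<in> V" for y
      using st that by (intro germ[OF V(1) that V(3-5)]) simp_all
    then show "\<exists>V s. openin T V \<and> x \<in> V \<and> V \<subseteq> U \<and> s \<in> sect R V \<and> (\<forall>y\<in>V. ?\<rho> y = germ T R y V s)"
      using V b[OF V(1,4,5)] by (intro exI[of _ V] exI[of _ "b V s t"]) simp
  qed
  show "sheafify_val vR ?\<rho> x = \<beta> (sheafify_val vP \<sigma> x) (sheafify_val vQ \<tau> x)" if "x \<in> U"
  proof -
    obtain V s t where V: "openin T V" "x \<in> V" "V \<subseteq> U" "s \<in> sect P V" "t \<in> sect Q V"
      and st: "\<forall>y\<in>V. \<sigma> y = germ T P y V s \<and> \<tau> y = germ T Q y V t"
      using ex[OF \<open>x \<in> U\<close>] by (elim exE conjE) (rule that)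
    have st: "\<sigma> x = germ T P x V s" "\<tau> x = germ T Q x V t" using st V(2) by simp_all
    show ?thesis
      using sheafify_val_germ[OF R V(1) b[OF V(1,4,5)] V(2), of ?\<rho>] germ[OF V st] st
        sheafify_val_germ[OF P V(1,4,2), of \<sigma>] sheafify_val_germ[OF Q V(1,5,2), of \<tau>] vb[OF V(1,4,5,2)] by simp
  qed
qed

text \<open>As for \<open>sheafify_map2\<close>, with neighbourhoods of \<open>h x\<close> pulled
  back to neighbourhoods of \<open>x\<close> by continuity; on values the operation is composition
  with \<open>h\<close>.\<close>

lemma sheafify_pullback:
  assumes h: "continuous_map T T' h" and P: "valued_presheaf T' P vP" and Q: "valued_presheaf T Q vQ"
    and c: "\<And>V s. openin T' V \<Longrightarrow> s \<in> sect P V \<Longrightarrow> c V s \<in> sect Q (preim T h V)"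
    and vc: "\<And>V s x. openin T' V \<Longrightarrow> s \<in> sect P V \<Longrightarrow> x \<in> preim T h V \<Longrightarrow> vQ (c V s) x = vP s (h x)"
    and \<sigma>: "\<sigma> \<in> sect (sheafify T' P) U"
  shows "sheafify_pullback T T' h P Q c U \<sigma> \<in> sect (sheafify T Q) (preim T h U)"
    and "x \<in> preim T h U \<Longrightarrow> sheafify_val vQ (sheafify_pullback T T' h P Q c U \<sigma>) x = sheafify_val vP \<sigma> (h x)"
proof -
  let ?\<rho> = "sheafify_pullback T T' h P Q c U \<sigma>"
  have op: "openin T (preim T h V)" if "openin T' V" for V
    using openin_continuous_map_preimage[OF h that] .
  have germ: "?\<rho> x = germ T Q x (preim T h V) (c V s)"
    if V: "openin T' V" "x \<in> preim T h V" "V \<subseteq> U" "s \<in> sect P V" and s: "\<sigma> (h x) = germ T' P (h x) V s" for x V s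
  proof -
    have hx: "h x \<in> V" "x \<in> topspace T" using V(2) by auto
    have "germ T Q x (preim T h V') (c V' s') = germ T Q x (preim T h V) (c V s)"
      if V': "openin T' V'" "h x \<in> V'" "s' \<in> sect P V'" and s': "\<sigma> (h x) = germ T' P (h x) V' s'" for V' s'
    proof -
      obtain A where A: "openin T' A" "h x \<in> A" "A \<subseteq> V'" "A \<subseteq> V" "\<And>y. y \<in> A \<Longrightarrow> vP s' y = vP s y"
        by (rule germ_eqE[OF P V'(1,3,2) V(1,4) hx(1) trans[OF s'[symmetric] s]]) (rule that)
      show ?thesis
      proof (rule germ_eqI[OF Q op[OF V'(1)] c[OF V'(1,3)] op[OF V(1)] c[OF V(1,4)] op[OF A(1)]])
        show "x \<in> preim T h A" "preim T h A \<subseteq> preim T h V'" "preim T h A \<subseteq> preim T h V"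
          using A hx by auto
        fix y assume "y \<in> preim T h A"
        then have y: "y \<in> preim T h V'" "y \<in> preim T h V" "h y \<in> A"
          using A(3,4) by auto
        show "vQ (c V' s') y = vQ (c V s) y"
          unfolding vc[OF V'(1,3) y(1)] vc[OF V(1,4) y(2)] by (rule A(5)[OF y(3)])
      qed
    qed
    note unique = this
    have x: "x \<in> preim T h U" using V by blast
    show ?thesis
      unfolding sheafify_pullback_def restrict_apply'[OF x]
    proof (intro the_equality)
      fix g assume "\<exists>V s. openin T' V \<and> h x \<in> V \<and> V \<subseteq> U \<and> s \<in> sect P V \<and>
        \<sigma> (h x) = germ T' P (h x) V s \<and> g = germ T Q x (preim T h V) (c V s)"
      then obtain V' s' where "openin T' V'" "h x \<in> V'" "s' \<in> sect P V'"
        "\<sigma> (h x) = germ T' P (h x) V' s'" and g: "g = germ T Q x (preim T h V') (c V' s')"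
        by (elim exE conjE) (rule that)
      then show "g = germ T Q x (preim T h V) (c V s)"
        unfolding g by (intro unique)
    qed (use V hx s in blast)
  qed
  have ex: "\<exists>V s. openin T' V \<and> x \<in> preim T h V \<and> V \<subseteq> U \<and> s \<in> sect P V \<and>
      (\<forall>y\<in>preim T h V. \<sigma> (h y) = germ T' P (h y) V s)" if x: "x \<in> preim T h U" for x
  proof -
    have "h x \<in> U" using x by simp
    then obtain V s where "openin T' V" "h x \<in> V" "V \<subseteq> U" "s \<in> sect P V" "\<And>y. y \<in> V \<Longrightarrow> \<sigma> y = germ T' P y V s"
      using sect_sheafifyE[OF \<sigma>] by blast
    with x show ?thesis by (intro exI[of _ V] exI[of _ s]) simp
  qed
  show "?\<rho> \<in> sect (sheafify T Q) (preim T h U)"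
    unfolding sect_sheafify_iff
  proof (intro conjI ballI)
    show "?\<rho> \<in> extensional (preim T h U)" unfolding sheafify_pullback_def by (rule restrict_extensional)
    fix x assume x: "x \<in> preim T h U"
    obtain V s where V: "openin T' V" "x \<in> preim T h V" "V \<subseteq> U" "s \<in> sect P V"
      and s: "\<forall>y\<in>preim T h V. \<sigma> (h y) = germ T' P (h y) V s" using ex[OF x] by (elim exE conjE) (rule that)
    have "?\<rho> y = germ T Q y (preim T h V) (c V s)" if "y \<in> preim T h V" for y
      by (rule germ[OF V(1) that V(3,4) bspec[OF s that]])
    moreover have "preim T h V \<subseteq> preim T h U" using V(3) by blast
    ultimately show "\<exists>V s. openin T V \<and> x \<in> V \<and> V \<subseteq> preim T h U \<and> s \<in> sect Q V \<and> (\<forall>y\<in>V. ?\<rho> y = germ T Q y V s)"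
      using V(2) c[OF V(1,4)] op[OF V(1)] by (intro exI[of _ "preim T h V"] exI[of _ "c V s"]) simp
  qed
  show "sheafify_val vQ ?\<rho> x = sheafify_val vP \<sigma> (h x)" if "x \<in> preim T h U"
  proof -
    obtain V s where V: "openin T' V" "x \<in> preim T h V" "V \<subseteq> U" "s \<in> sect P V"
      and s: "\<forall>y\<in>preim T h V. \<sigma> (h y) = germ T' P (h y) V s"
      using ex[OF \<open>x \<in> preim T h U\<close>] by (elim exE conjE) (rule that)
    have s: "\<sigma> (h x) = germ T' P (h x) V s" using s V(2) by simp
    have "h x \<in> V" using V by simp
    then show ?thesis
      using sheafify_val_germ[OF Q op[OF V(1)] c[OF V(1,4)] V(2), of ?\<rho>] germ[OF V s] s
        sheafify_val_germ[OF P V(1,4), of "h x" \<sigma>] vc[OF V(1,4,2)] by simp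
  qed
qed

section \<open>The values of a correspondence\<close>

lemma tuple_class_eqI:
  assumes "(A, B) \<in> tuple_rel Y X n U"
  shows "tuple_rel Y X n U `` {A} = tuple_rel Y X n U `` {B}"
  using assms by (auto simp: tuple_rel_def)

lemma tuple_rel_refl: "A \<in> tuples Y X n U \<Longrightarrow> (A, A) \<in> tuple_rel Y X n U"
  by (simp add: tuple_rel_def)

lemma sect_tuple_presheaf_class:
  "A \<in> tuples Y X n U \<Longrightarrow> tuple_rel Y X n U `` {A} \<in> sect (tuple_presheaf Y X n) U"
  by (simp add: tuple_presheaf_def quotientI)

lemma sect_tuple_presheafE:
  assumes "c \<in> sect (tuple_presheaf Y X n) U"
  obtains A where "A \<in> tuples Y X n U" "c = tuple_rel Y X n U `` {A}"
  using assms by (auto simp: tuple_presheaf_def elim: quotientE)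

text \<open>Operations on classes are defined as unions over all representatives; compatibility with
  \<open>tuple_rel\<close> makes all sets in such a union equal.\<close>

lemma UN_tuple_class:
  assumes "A \<in> tuples Y X n U"
    and "\<And>B. (A, B) \<in> tuple_rel Y X n U \<Longrightarrow> (\<phi> A, \<phi> B) \<in> tuple_rel Z W m V"
  shows "(\<Union>B\<in>tuple_rel Y X n U `` {A}. tuple_rel Z W m V `` {\<phi> B}) = tuple_rel Z W m V `` {\<phi> A}"
proof -
  have "tuple_rel Z W m V `` {\<phi> B} = tuple_rel Z W m V `` {\<phi> A}" if "(A, B) \<in> tuple_rel Y X n U" for B
    by (rule tuple_class_eqI[OF assms(2)[OF that], symmetric])
  then show ?thesis
    using tuple_rel_refl[OF assms(1)] by blast
qed

text \<open>For a class over \<open>U\<close> the choice is immaterial at points of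
  \<open>U\<close>, where \<open>tuple_rel\<close> equates the value multisets.\<close>

definition tuple_val :: "('y, 'x) tuple_class \<Rightarrow> 'y \<Rightarrow> 'x multiset" where
  "tuple_val c y = image_mset (\<lambda>f. f y) (SOME A. A \<in> c)"

lemma tuple_val_class:
  assumes "A \<in> tuples Y X n U" "y \<in> U"
  shows "tuple_val (tuple_rel Y X n U `` {A}) y = image_mset (\<lambda>f. f y) A"
proof -
  have "(SOME B. B \<in> tuple_rel Y X n U `` {A}) \<in> tuple_rel Y X n U `` {A}"
    by (rule someI[of _ A]) (simp add: tuple_rel_refl[OF assms(1)])
  then show ?thesis
    using assms(2) by (simp add: tuple_val_def tuple_rel_def)
qed

lemma tuples_pullback:
  assumes at: "smooth_atlas Y" "smooth_atlas Z" "smooth_atlas X"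
    and h: "pseudoholomorphic Y Z h" and V: "openin (mtop Z) V" and A: "A \<in> tuples Z X n V"
  shows "image_mset (\<lambda>f. restrict (f \<circ> h) (preim (mtop Y) h V)) A \<in> tuples Y X n (preim (mtop Y) h V)"
proof -
  let ?W = "preim (mtop Y) h V"
  have h': "pseudoholomorphic_on Y Z (topspace (mtop Y)) h"
    using h by (simp add: pseudoholomorphic_on_topspace at)
  have "continuous_map (mtop Y) (mtop Z) h"
    using h by (simp add: pseudoholomorphic_def smooth_map_def)
  then have W: "openin (mtop Y) ?W"
    using V by (rule openin_continuous_map_preimage)
  have "pseudoholomorphic (open_submanifold Y ?W) X (restrict (f \<circ> h) ?W)" if "f \<in># A" for f
  proof -
    have "pseudoholomorphic_on Z X V f"
      using A that pseudoholomorphic_open_submanifold[OF at(2,3) V] by (auto simp: tuples_def)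
    from pseudoholomorphic_on_compose[OF at openin_topspace h' this V]
    have "pseudoholomorphic_on Y X ?W (restrict (f \<circ> h) ?W)"
      by (rule pseudoholomorphic_on_cong_subset[OF at(1,3) W order_refl]) simp
    then show ?thesis
      by (simp add: pseudoholomorphic_open_submanifold[OF at(1,3) W])
  qed
  then show ?thesis
    using A by (auto simp: tuples_def)
qed

lemma tuples_restrict:
  assumes at: "smooth_atlas Y" "smooth_atlas X"
    and U: "openin (mtop Y) U" and V: "openin (mtop Y) V" "V \<subseteq> U" and A: "A \<in> tuples Y X n U"
  shows "image_mset (\<lambda>f. restrict f V) A \<in> tuples Y X n V"
proof -
  have "pseudoholomorphic (open_submanifold Y V) X (restrict f V)" if "f \<in># A" for f
  proof -
    have "pseudoholomorphic_on Y X U f"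
      using A that pseudoholomorphic_open_submanifold[OF at U] by (auto simp: tuples_def)
    then have "pseudoholomorphic_on Y X V (restrict f V)"
      by (rule pseudoholomorphic_on_cong_subset[OF at V]) simp
    then show ?thesis
      by (simp add: pseudoholomorphic_open_submanifold[OF at V(1)])
  qed
  then show ?thesis
    using A by (auto simp: tuples_def)
qed

lemma tuples_add: "A \<in> tuples Y X n U \<Longrightarrow> B \<in> tuples Y X m U \<Longrightarrow> A + B \<in> tuples Y X (n + m) U"
  by (auto simp: tuples_def)

text \<open>Determination by values is built into the identification of tuples; the work lies in
  showing that restriction is well defined on classes and keeps values.\<close>

lemma valued_tuple_presheaf:
  assumes at: "smooth_atlas Y" "smooth_atlas X"
  shows "valued_presheaf (mtop Y) (tuple_presheaf Y X n) tuple_val"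
  unfolding valued_presheaf_def
proof (intro conjI allI impI; elim conjE)
  fix U V c assume U: "openin (mtop Y) U" and V: "openin (mtop Y) V" "V \<subseteq> U"
    and "c \<in> sect (tuple_presheaf Y X n) U"
  then obtain A where A: "A \<in> tuples Y X n U" "c = tuple_rel Y X n U `` {A}"
    by (elim sect_tuple_presheafE)
  note r = tuples_restrict[OF at U V]
  have *: "(image_mset (\<lambda>f. restrict f V) A, image_mset (\<lambda>f. restrict f V) B) \<in> tuple_rel Y X n V"
    if "(A, B) \<in> tuple_rel Y X n U" for B
    using that V(2) r[of A] r[of B] by (auto simp: tuple_rel_def image_mset.compositionality o_def)
  then have res: "res (tuple_presheaf Y X n) U V c = tuple_rel Y X n V `` {image_mset (\<lambda>f. restrict f V) A}"
    unfolding tuple_presheaf_def A(2)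
    by (simp add: UN_tuple_class[where \<phi> = "image_mset (\<lambda>f. restrict f V)", OF A(1) *])
  show "res (tuple_presheaf Y X n) U V c \<in> sect (tuple_presheaf Y X n) V"
    unfolding res by (rule sect_tuple_presheaf_class[OF r[OF A(1)]])
  show "\<forall>x\<in>V. tuple_val (res (tuple_presheaf Y X n) U V c) x = tuple_val c x"
    unfolding res unfolding A(2) using V(2) A(1) r[OF A(1)]
    by (auto simp: tuple_val_class subset_iff image_mset.compositionality o_def)
next
  fix U c d assume "c \<in> sect (tuple_presheaf Y X n) U" "d \<in> sect (tuple_presheaf Y X n) U"
    and eq: "\<forall>x\<in>U. tuple_val c x = tuple_val d x"
  then obtain A B where A: "A \<in> tuples Y X n U" "c = tuple_rel Y X n U `` {A}"
    and B: "B \<in> tuples Y X n U" "d = tuple_rel Y X n U `` {B}"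
    by (elim sect_tuple_presheafE)
  have "(A, B) \<in> tuple_rel Y X n U"
    using eq tuple_val_class[OF A(1)] tuple_val_class[OF B(1)] A(1) B(1)
    by (subst tuple_rel_def) (simp add: A(2) B(2))
  then show "c = d"
    unfolding A(2) B(2) by (rule tuple_class_eqI)
qed

lemma tuple_add_class:
  assumes "c \<in> sect (tuple_presheaf Y X n) U" "d \<in> sect (tuple_presheaf Y X m) U"
  shows "tuple_add Y X n m U c d \<in> sect (tuple_presheaf Y X (n + m)) U"
    and "x \<in> U \<Longrightarrow> tuple_val (tuple_add Y X n m U c d) x = tuple_val c x + tuple_val d x"
proof -
  obtain A B where A: "A \<in> tuples Y X n U" "c = tuple_rel Y X n U `` {A}"
    and B: "B \<in> tuples Y X m U" "d = tuple_rel Y X m U `` {B}"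
    using assms by (elim sect_tuple_presheafE)
  \<comment> \<open>The double union is collapsed one variable at a time, the inner one for every
    fixed \<open>A'\<close>.\<close>
  have "(\<Union>B'\<in>d. tuple_rel Y X (n + m) U `` {A' + B'}) = tuple_rel Y X (n + m) U `` {A' + B}"
    if "A' \<in> tuples Y X n U" for A'
    unfolding B(2)
    by (rule UN_tuple_class[OF B(1)]) (use that in \<open>auto simp: tuple_rel_def tuples_add\<close>)
  moreover have "A' \<in> tuples Y X n U" if "A' \<in> c" for A'
    using that by (simp add: A(2) tuple_rel_def)
  ultimately have "tuple_add Y X n m U c d = (\<Union>A'\<in>c. tuple_rel Y X (n + m) U `` {A' + B})"
    by (simp add: tuple_add_def)
  also have "\<dots> = tuple_rel Y X (n + m) U `` {A + B}"
    unfolding A(2)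
    by (rule UN_tuple_class[OF A(1)]) (use B(1) in \<open>auto simp: tuple_rel_def tuples_add\<close>)
  finally have eq: "tuple_add Y X n m U c d = tuple_rel Y X (n + m) U `` {A + B}" .
  note AB = tuples_add[OF A(1) B(1)]
  show "tuple_add Y X n m U c d \<in> sect (tuple_presheaf Y X (n + m)) U"
    unfolding eq by (rule sect_tuple_presheaf_class[OF AB])
  show "tuple_val (tuple_add Y X n m U c d) x = tuple_val c x + tuple_val d x" if "x \<in> U"
    unfolding eq tuple_val_class[OF AB that] unfolding A(2) B(2)
    by (simp add: tuple_val_class[OF A(1) that] tuple_val_class[OF B(1) that])
qed

lemma tuple_pullback_class:
  fixes Y :: "('y, 'i, 'e::real_normed_vector) ac_manifold"
    and Z :: "('z, 'k, 'g::real_normed_vector) ac_manifold"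
    and X :: "('x, 'j, 'f::real_normed_vector) ac_manifold"
  assumes at: "smooth_atlas Y" "smooth_atlas Z" "smooth_atlas X"
    and h: "pseudoholomorphic Y Z h" and V: "openin (mtop Z) V" and "c \<in> sect (tuple_presheaf Z X n) V"
  shows "tuple_pullback Y X h n V c \<in> sect (tuple_presheaf Y X n) (preim (mtop Y) h V)"
    and "x \<in> preim (mtop Y) h V \<Longrightarrow> tuple_val (tuple_pullback Y X h n V c) x = tuple_val c (h x)"
proof -
  let ?W = "preim (mtop Y) h V"
  let ?\<phi> = "image_mset (\<lambda>f. restrict (f \<circ> h) ?W) :: ('z \<Rightarrow> 'x) multiset \<Rightarrow> ('y \<Rightarrow> 'x) multiset"
  obtain A where A: "A \<in> tuples Z X n V" "c = tuple_rel Z X n V `` {A}"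
    using assms(6) by (elim sect_tuple_presheafE)
  note r = tuples_pullback[OF at h V]
  have *: "(?\<phi> A, ?\<phi> B) \<in> tuple_rel Y X n ?W" if "(A, B) \<in> tuple_rel Z X n V" for B
    using that r[of A n] r[of B n] by (auto simp: tuple_rel_def image_mset.compositionality o_def)
  have eq: "tuple_pullback Y X h n V c = tuple_rel Y X n ?W `` {?\<phi> A}"
    unfolding tuple_pullback_def A(2)
    by (rule UN_tuple_class[where \<phi> = ?\<phi>, OF A(1) *])
  show "tuple_pullback Y X h n V c \<in> sect (tuple_presheaf Y X n) ?W"
    unfolding eq by (rule sect_tuple_presheaf_class[OF r[OF A(1)]])
  show "tuple_val (tuple_pullback Y X h n V c) x = tuple_val c (h x)" if x: "x \<in> ?W"
  proof -
    have "h x \<in> V" using x by simp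
    then show ?thesis
      unfolding eq tuple_val_class[OF r[OF A(1)] x] unfolding A(2)
      using x by (simp add: tuple_val_class[OF A(1)] image_mset.compositionality o_def)
  qed
qed

text \<open>Dropping the label \<open>n\<close> loses nothing over a nonempty set: it is the size of
  every value.\<close>

definition coprod_val :: "nat \<times> ('y, ('y, 'x) tuple_class) germs \<Rightarrow> 'y \<Rightarrow> 'x multiset" where
  "coprod_val p = sheafify_val tuple_val (snd p)"

lemma coprod_val_Pair [simp]: "coprod_val (n, \<sigma>) = sheafify_val tuple_val \<sigma>"
  by (simp add: coprod_val_def)

lemma sect_coprod_presheaf [simp]:
  "(n, \<sigma>) \<in> sect (coprod_presheaf Y X) U \<longleftrightarrow> \<sigma> \<in> sect (sheafify (mtop Y) (tuple_presheaf Y X n)) U"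
  by (simp add: coprod_presheaf_def jcor_n_sheaf_def)

text \<open>Locally the section is a tuple of length \<open>n\<close>. The summand of the coproduct
  can thus be read off at any single point.\<close>

lemma size_sheafify_tuple_val:
  assumes at: "smooth_atlas Y" "smooth_atlas X"
    and "\<sigma> \<in> sect (sheafify (mtop Y) (tuple_presheaf Y X n)) U" "x \<in> U"
  shows "size (sheafify_val tuple_val \<sigma> x) = n"
proof -
  obtain V s where V: "openin (mtop Y) V" "x \<in> V" "s \<in> sect (tuple_presheaf Y X n) V"
    "\<And>y. y \<in> V \<Longrightarrow> \<sigma> y = germ (mtop Y) (tuple_presheaf Y X n) y V s"
    by (rule sect_sheafifyE[OF assms(3,4)]) (rule that)
  obtain A where A: "A \<in> tuples Y X n V" "s = tuple_rel Y X n V `` {A}"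
    using V(3) by (elim sect_tuple_presheafE)
  have "sheafify_val tuple_val \<sigma> x = image_mset (\<lambda>f. f x) A"
    using sheafify_val_germ[where \<sigma> = \<sigma>, OF valued_tuple_presheaf[OF at] V(1,3,2) V(4)[OF V(2)]]
      tuple_val_class[OF A(1) V(2)] by (simp add: A(2))
  then show ?thesis using A(1) by (simp add: tuples_def)
qed

lemma valued_coprod_presheaf:
  assumes at: "smooth_atlas Y" "smooth_atlas X"
  shows "valued_presheaf (mtop Y) (coprod_presheaf Y X) coprod_val"
  unfolding valued_presheaf_def
proof (intro conjI allI impI; elim conjE)
  note sh = valued_presheaf_sheafify[OF valued_tuple_presheaf[OF at]]
  fix U V p assume U: "openin (mtop Y) U" and V: "openin (mtop Y) V" "V \<subseteq> U"
    and "p \<in> sect (coprod_presheaf Y X) U"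
  then obtain n \<sigma> where p: "p = (n, \<sigma>)" "\<sigma> \<in> sect (sheafify (mtop Y) (tuple_presheaf Y X n)) U"
    by (cases p) simp
  have res: "res (coprod_presheaf Y X) U V p = (n, res (sheafify (mtop Y) (tuple_presheaf Y X n)) U V \<sigma>)"
    by (simp add: coprod_presheaf_def jcor_n_sheaf_def p(1))
  note r = valued_presheaf_res[OF sh U V p(2)]
  show "res (coprod_presheaf Y X) U V p \<in> sect (coprod_presheaf Y X) V"
    unfolding res using r(1) by simp
  show "\<forall>x\<in>V. coprod_val (res (coprod_presheaf Y X) U V p) x = coprod_val p x"
    unfolding res unfolding p(1) using r(2) by simp
next
  note tv = valued_tuple_presheaf[OF at]
  fix U p q assume "U \<noteq> {}" and sect: "p \<in> sect (coprod_presheaf Y X) U" "q \<in> sect (coprod_presheaf Y X) U"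
    and eq: "\<forall>x\<in>U. coprod_val p x = coprod_val q x"
  obtain n \<sigma> where p: "p = (n, \<sigma>)" by (cases p)
  obtain m \<tau> where q: "q = (m, \<tau>)" by (cases q)
  \<comment> \<open>The labels \<open>n\<close> and \<open>m\<close> are compared through the size
    of the common value at this point.\<close>
  obtain x where x: "x \<in> U" using \<open>U \<noteq> {}\<close> by blast
  have sigma: "\<sigma> \<in> sect (sheafify (mtop Y) (tuple_presheaf Y X n)) U"
    and tau: "\<tau> \<in> sect (sheafify (mtop Y) (tuple_presheaf Y X m)) U"
    using sect by (simp_all add: p q)
  have val: "sheafify_val tuple_val \<sigma> y = sheafify_val tuple_val \<tau> y" if "y \<in> U" for y
    using eq that by (simp add: p q)
  have "n = m"
    using size_sheafify_tuple_val[OF at sigma x] size_sheafify_tuple_val[OF at tau x] val[OF x] by simp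
  moreover have "\<sigma> = \<tau>"
    using sigma tau[folded \<open>n = m\<close>] val by (rule sect_sheafify_eqI[OF tv])
  ultimately show "p = q" by (simp add: p q)
qed

section \<open>Values of sums, of the empty correspondence and of pullbacks\<close>

abbreviation corr_val :: "('y, 'x) jcor \<Rightarrow> 'y \<Rightarrow> 'x multiset" where
  "corr_val \<equiv> sheafify_val coprod_val"

lemma JCor_eqI:
  assumes "smooth_atlas Y" "smooth_atlas X" "F \<in> JCor Y X" "G \<in> JCor Y X"
    and "\<And>y. y \<in> topspace (mtop Y) \<Longrightarrow> corr_val F y = corr_val G y"
  shows "F = G"
  using sect_sheafify_eqI[OF valued_coprod_presheaf[OF assms(1,2)] assms(3,4)[unfolded JCor_def] assms(5)] .

lemma JCor_add:
  assumes at: "smooth_atlas Y" "smooth_atlas X" and F: "F \<in> JCor Y X" and G: "G \<in> JCor Y X"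
  shows "JCor_add Y X F G \<in> JCor Y X"
    and "y \<in> topspace (mtop Y) \<Longrightarrow> corr_val (JCor_add Y X F G) y = corr_val F y + corr_val G y"
proof -
  note tv = valued_tuple_presheaf[OF at] and cv = valued_coprod_presheaf[OF at]
  \<comment> \<open>The inner sheafification, for fixed labels; the outcome is the presheaf
    operation that the outer sheafification extends.\<close>
  have *: "coprod_add Y X V p q \<in> sect (coprod_presheaf Y X) V \<and>
      (\<forall>x\<in>V. coprod_val (coprod_add Y X V p q) x = coprod_val p x + coprod_val q x)"
    if "p \<in> sect (coprod_presheaf Y X) V" "q \<in> sect (coprod_presheaf Y X) V" for V p q
  proof -
    obtain n \<sigma> where p: "p = (n, \<sigma>)" by (cases p)
    obtain m \<tau> where q: "q = (m, \<tau>)" by (cases q)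
    have "\<sigma> \<in> sect (sheafify (mtop Y) (tuple_presheaf Y X n)) V"
      "\<tau> \<in> sect (sheafify (mtop Y) (tuple_presheaf Y X m)) V"
      using that by (simp_all add: p q)
    note m2 = sheafify_map2[where \<beta> = "(+)", OF tv tv tv tuple_add_class this]
    show ?thesis
      unfolding p q coprod_add_def using m2 by simp
  qed
  show "JCor_add Y X F G \<in> JCor Y X"
    and "y \<in> topspace (mtop Y) \<Longrightarrow> corr_val (JCor_add Y X F G) y = corr_val F y + corr_val G y"
    unfolding JCor_add_def JCor_def using F G *
    by (intro sheafify_map2[where \<beta> = "(+)", OF cv cv cv]; simp add: JCor_def)+
qed

lemma empty_corr:
  assumes at: "smooth_atlas Y" "smooth_atlas X"
  shows "empty_corr Y X \<in> JCor Y X"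
    and "y \<in> topspace (mtop Y) \<Longrightarrow> corr_val (empty_corr Y X) y = {#}"
proof -
  note tv = valued_tuple_presheaf[OF at] and cv = valued_coprod_presheaf[OF at]
  let ?U = "topspace (mtop Y)"
  have s: "{{#}} \<in> sect (tuple_presheaf Y X 0) ?U"
    by (simp add: sect_tuple_presheaf_0)
  have n: "empty_corr_n Y X \<in> sect (sheafify (mtop Y) (tuple_presheaf Y X 0)) ?U"
    using jcor_n_0[of Y X] by (auto simp: JCor_n_def jcor_n_sheaf_def)
  then have sect: "(0, empty_corr_n Y X) \<in> sect (coprod_presheaf Y X) ?U"
    by simp
  show "empty_corr Y X \<in> JCor Y X"
    unfolding JCor_def by (rule sect_sheafifyI[OF openin_topspace sect]) (simp_all add: empty_corr_def)
  assume y: "y \<in> ?U"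
  have "corr_val (empty_corr Y X) y = coprod_val (0, empty_corr_n Y X) y"
    by (rule sheafify_val_germ[OF cv openin_topspace sect y]) (simp add: empty_corr_def y)
  \<comment> \<open>Values in the summand with label 0 have size 0.\<close>
  also have "\<dots> = {#}"
    using size_sheafify_tuple_val[OF at n y] by simp
  finally show "corr_val (empty_corr Y X) y = {#}" .
qed

lemma JCor_pullback:
  assumes at: "smooth_atlas Y" "smooth_atlas Z" "smooth_atlas X"
    and h: "pseudoholomorphic Y Z h" and F: "F \<in> JCor Z X"
  shows "JCor_pullback Y Z X h F \<in> JCor Y X"
    and "y \<in> topspace (mtop Y) \<Longrightarrow> corr_val (JCor_pullback Y Z X h F) y = corr_val F (h y)"
proof -
  note tv = valued_tuple_presheaf[OF at(1,3)] valued_tuple_presheaf[OF at(2,3)]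
    and cv = valued_coprod_presheaf[OF at(1,3)] valued_coprod_presheaf[OF at(2,3)]
  have cont: "continuous_map (mtop Y) (mtop Z) h"
    using h by (simp add: pseudoholomorphic_def smooth_map_def)
  have *: "coprod_pullback Y Z X h V p \<in> sect (coprod_presheaf Y X) (preim (mtop Y) h V) \<and>
      (\<forall>x\<in>preim (mtop Y) h V. coprod_val (coprod_pullback Y Z X h V p) x = coprod_val p (h x))"
    if "p \<in> sect (coprod_presheaf Z X) V" for V p
  proof -
    obtain n \<sigma> where p: "p = (n, \<sigma>)" by (cases p)
    have "\<sigma> \<in> sect (sheafify (mtop Z) (tuple_presheaf Z X n)) V"
      using that by (simp add: p)
    note pb = sheafify_pullback[OF cont tv(2,1) tuple_pullback_class[OF at h] this]
    show ?thesis
      unfolding p coprod_pullback_def using pb by simp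
  qed
  have top: "preim (mtop Y) h (topspace (mtop Z)) = topspace (mtop Y)"
    using cont by (auto simp: continuous_map_def)
  note pb = sheafify_pullback[OF cont cv(2,1) conjunct1[OF *] bspec[OF conjunct2[OF *]] F[unfolded JCor_def],
      folded JCor_pullback_def, unfolded top]
  show "JCor_pullback Y Z X h F \<in> JCor Y X"
    unfolding JCor_def by (rule pb(1))
  show "corr_val (JCor_pullback Y Z X h F) y = corr_val F (h y)" if "y \<in> topspace (mtop Y)"
    by (rule pb(2)) (use that in simp_all)
qed

section \<open>Homotopy of formal differences\<close>

definition diff_class ::
  "('y, 'i, 'e::real_normed_vector) ac_manifold \<Rightarrow> ('x, 'j, 'f::real_normed_vector) ac_manifold \<Rightarrow>
   ('y, 'x) jcor \<Rightarrow> ('y, 'x) jcor \<Rightarrow> ('y, 'x) jc" where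
  "diff_class Y X a b = grothendieck_rel (JCor_monoid Y X) `` {(a, b)}"

text \<open>Multisets are cancellative, so the stabilizing summand in the Grothendieck relation is redundant.\<close>

lemma grothendieck_rel_JCor_iff:
  assumes at: "smooth_atlas Y" "smooth_atlas X"
  shows "((a, b), (c, d)) \<in> grothendieck_rel (JCor_monoid Y X) \<longleftrightarrow>
    a \<in> JCor Y X \<and> b \<in> JCor Y X \<and> c \<in> JCor Y X \<and> d \<in> JCor Y X \<and>
    (\<forall>y\<in>topspace (mtop Y). corr_val a y + corr_val d y = corr_val c y + corr_val b y)"
proof -
  have "(\<exists>k\<in>JCor Y X. JCor_add Y X (JCor_add Y X a d) k = JCor_add Y X (JCor_add Y X c b) k) \<longleftrightarrow>
      (\<forall>y\<in>topspace (mtop Y). corr_val a y + corr_val d y = corr_val c y + corr_val b y)" (is "?L \<longleftrightarrow> ?R")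
    if m: "a \<in> JCor Y X" "b \<in> JCor Y X" "c \<in> JCor Y X" "d \<in> JCor Y X"
  proof
    note ad = JCor_add[OF at m(1,4)] and cb = JCor_add[OF at m(3,2)]
    show ?R if l: ?L
    proof
      fix y assume y: "y \<in> topspace (mtop Y)"
      obtain k where k: "k \<in> JCor Y X"
        and eq: "JCor_add Y X (JCor_add Y X a d) k = JCor_add Y X (JCor_add Y X c b) k"
        using l by blast
      have "corr_val (JCor_add Y X (JCor_add Y X a d) k) y = corr_val (JCor_add Y X (JCor_add Y X c b) k) y"
        by (simp only: eq)
      then show "corr_val a y + corr_val d y = corr_val c y + corr_val b y"
        using y by (simp add: JCor_add[OF at] ad cb k)
    qed
    show ?L if ?R
    proof
      have "JCor_add Y X a d = JCor_add Y X c b"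
        by (rule JCor_eqI[OF at ad(1) cb(1)]) (simp add: ad cb that)
      \<comment> \<open>The stabilizing summand is taken to be the empty correspondence.\<close>
      then show "JCor_add Y X (JCor_add Y X a d) (empty_corr Y X) = JCor_add Y X (JCor_add Y X c b) (empty_corr Y X)"
        by simp
    qed (rule empty_corr[OF at])
  qed
  then show ?thesis
    by (auto simp: grothendieck_rel_def JCor_monoid_def)
qed

lemma equiv_grothendieck_rel_JCor:
  assumes at: "smooth_atlas Y" "smooth_atlas X"
  shows "equiv (JCor Y X \<times> JCor Y X) (grothendieck_rel (JCor_monoid Y X))"
proof (rule equivI)
  show "trans (grothendieck_rel (JCor_monoid Y X))"
  proof (rule transI, clarify)
    fix a b c d e f
    assume "((a, b), c, d) \<in> grothendieck_rel (JCor_monoid Y X)" "((c, d), e, f) \<in> grothendieck_rel (JCor_monoid Y X)"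
    note 1 = this[unfolded grothendieck_rel_JCor_iff[OF at]]
    have "corr_val a y + corr_val f y = corr_val e y + corr_val b y" if y: "y \<in> topspace (mtop Y)" for y
    proof -
      have "corr_val a y + corr_val d y = corr_val c y + corr_val b y"
        "corr_val c y + corr_val f y = corr_val e y + corr_val d y"
        using 1 y by auto
      \<comment> \<open>Sum of the two equations, regrouped so that
        \<open>corr_val c y + corr_val d y\<close> can be cancelled.\<close>
      then have "(corr_val a y + corr_val f y) + (corr_val c y + corr_val d y) =
          (corr_val e y + corr_val b y) + (corr_val c y + corr_val d y)"
        by (metis (no_types, opaque_lifting) add.assoc add.commute)
      then show ?thesis by simp
    qed
    with 1 show "((a, b), e, f) \<in> grothendieck_rel (JCor_monoid Y X)"
      unfolding grothendieck_rel_JCor_iff[OF at] by blast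
  qed
qed (auto simp: grothendieck_rel_JCor_iff[OF at] intro!: refl_onI symI)

lemma diff_class_eq_iff:
  assumes "smooth_atlas Y" "smooth_atlas X"
    and "a \<in> JCor Y X" "b \<in> JCor Y X" "c \<in> JCor Y X" "d \<in> JCor Y X"
  shows "diff_class Y X a b = diff_class Y X c d \<longleftrightarrow>
    (\<forall>y\<in>topspace (mtop Y). corr_val a y + corr_val d y = corr_val c y + corr_val b y)"
  unfolding diff_class_def using assms
  by (subst eq_equiv_class_iff[OF equiv_grothendieck_rel_JCor]) (simp_all add: grothendieck_rel_JCor_iff)

lemma carrier_JC: "carrier (JC Y X) = (\<lambda>(a, b). diff_class Y X a b) ` (JCor Y X \<times> JCor Y X)"
  by (auto simp: JC_def grothendieck_group_def JCor_monoid_def diff_class_def quotient_def)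

text \<open>The equation placing \<open>(c, d)\<close> in the class of \<open>(a, b)\<close>, taken
  at \<open>h y\<close>, is the equation for the pullbacks at \<open>y\<close>. Hence all sets in
  the union defining \<open>grothendieck_map\<close> coincide.\<close>

lemma JC_comp_diff_class:
  assumes at: "smooth_atlas Y" "smooth_atlas Z" "smooth_atlas X"
    and h: "pseudoholomorphic Y Z h" and ab: "a \<in> JCor Z X" "b \<in> JCor Z X"
  shows "JC_comp Y Z X (diff_class Z X a b) h =
    diff_class Y X (JCor_pullback Y Z X h a) (JCor_pullback Y Z X h b)"
proof -
  note pb = JCor_pullback[OF at h]
  have hy: "h y \<in> topspace (mtop Z)" if "y \<in> topspace (mtop Y)" for y
    using h that by (auto simp: pseudoholomorphic_def smooth_map_def continuous_map_def)
  have "diff_class Y X (JCor_pullback Y Z X h c) (JCor_pullback Y Z X h d) =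
      diff_class Y X (JCor_pullback Y Z X h a) (JCor_pullback Y Z X h b)"
    if "(c, d) \<in> diff_class Z X a b" for c d
  proof -
    have "c \<in> JCor Z X" "d \<in> JCor Z X" and
      eq: "\<forall>z\<in>topspace (mtop Z). corr_val a z + corr_val d z = corr_val c z + corr_val b z"
      using that by (auto simp: diff_class_def grothendieck_rel_JCor_iff[OF at(2,3)])
    then show ?thesis
      using ab hy by (subst diff_class_eq_iff[OF at(1,3)]) (simp_all add: pb)
  qed
  moreover have "(a, b) \<in> diff_class Z X a b"
    using ab by (simp add: diff_class_def grothendieck_rel_JCor_iff[OF at(2,3)])
  ultimately show ?thesis
    unfolding JC_comp_def grothendieck_map_def diff_class_def[of Y, symmetric] by fast
qed

theorem lemma9p6:
  fixes X :: "('x, 'j, 'f::real_normed_vector) ac_manifold"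
    and Y :: "('y, 'i, 'e::real_normed_vector) ac_manifold"
    and M :: "('m, 'k, 'g::real_normed_vector) ac_manifold"
    and p\<^sub>0 p\<^sub>1 :: 'm
    and \<gamma> :: "'m \<Rightarrow> 'm"
  assumes "symplectic_ac_manifold X"
    and "symplectic_ac_manifold Y"
    and "symplectic_ac_manifold M"
    and "connected_space (mtop M)"
    and "p\<^sub>0 \<in> topspace (mtop M)" and "p\<^sub>1 \<in> topspace (mtop M)"
    and "pseudoholomorphic M M \<gamma>" and "\<gamma> p\<^sub>0 = p\<^sub>1" and "\<gamma> p\<^sub>1 = p\<^sub>0"
  shows "equiv (carrier (JC Y X)) (M_homotopy_rel M p\<^sub>0 p\<^sub>1 Y X)"
proof -
  let ?P = "prod_manifold Y M" and ?T = "topspace (mtop Y)"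
  have Y: "smooth_manifold Y" "almost_complex_structure Y" and M: "smooth_manifold M" "almost_complex_structure M"
    and X: "smooth_manifold X"
    using assms(1-3) by (simp_all add: symplectic_ac_manifold_def)
  note at = Y(1)[THEN smooth_atlas_smooth_manifold] M(1)[THEN smooth_atlas_smooth_manifold]
    X[THEN smooth_atlas_smooth_manifold]
  note atP = smooth_atlas_prod_manifold[OF at(1,2)]
  \<comment> \<open>The slice inclusion is the pairing of the identity with a constant map.\<close>
  have incl: "pseudoholomorphic Y ?P (\<lambda>y. (y, p))" if "p \<in> topspace (mtop M)" for p
    by (rule pseudoholomorphic_Pair[OF at(1,1,2) pseudoholomorphic_ident[OF Y]
          pseudoholomorphic_const[OF at(1,2) M(2) that]])
  note fst = pseudoholomorphic_fst[OF Y M(1)]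
  have swap: "pseudoholomorphic ?P ?P (\<lambda>q. (fst q, \<gamma> (snd q)))"
    using pseudoholomorphic_Pair[OF atP at(1,2) fst
        pseudoholomorphic_compose[OF atP at(2,2) pseudoholomorphic_snd[OF Y(1) M] assms(7)]]
    by (simp add: o_def)
  let ?i = "\<lambda>p. JCor_pullback Y ?P X (\<lambda>y. (y, p))"
    and ?pr = "JCor_pullback ?P Y X fst" and ?sw = "JCor_pullback ?P ?P X (\<lambda>q. (fst q, \<gamma> (snd q)))"
  note i = JCor_pullback[OF at(1) atP at(3) incl] and pr = JCor_pullback[OF atP at(1,3) fst]
    and sw = JCor_pullback[OF atP atP at(3) swap]
  note add = JCor_add[OF atP at(3)]
  \<comment> \<open>A homotopy is a formal difference \<open>a - b\<close> over the product, and its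
    endpoints are the differences of the two slices. This rule and the next translate between both
    descriptions.\<close>
  have homotopyI: "(F, G) \<in> M_homotopy_rel M p\<^sub>0 p\<^sub>1 Y X"
    if "a \<in> JCor ?P X" "b \<in> JCor ?P X" "F = diff_class Y X (?i p\<^sub>0 a) (?i p\<^sub>0 b)" "G = diff_class Y X (?i p\<^sub>1 a) (?i p\<^sub>1 b)"
    for a b F G
    unfolding M_homotopy_rel_def
    using that i(1)[OF assms(5)] i(1)[OF assms(6)]
    by (auto simp: carrier_JC JC_comp_diff_class[OF at(1) atP at(3) incl] assms(5,6) intro!: bexI[of _ "diff_class ?P X a b"])
  have homotopyE: "\<exists>a\<in>JCor ?P X. \<exists>b\<in>JCor ?P X.
      F = diff_class Y X (?i p\<^sub>0 a) (?i p\<^sub>0 b) \<and> G = diff_class Y X (?i p\<^sub>1 a) (?i p\<^sub>1 b)"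
    if "(F, G) \<in> M_homotopy_rel M p\<^sub>0 p\<^sub>1 Y X" for F G
    using that unfolding M_homotopy_rel_def carrier_JC
    by (auto simp: JC_comp_diff_class[OF at(1) atP at(3) incl] assms(5,6))
  note eq = diff_class_eq_iff[OF at(1,3)]
  show ?thesis
  proof (rule equivI)
    show "M_homotopy_rel M p\<^sub>0 p\<^sub>1 Y X \<subseteq> carrier (JC Y X) \<times> carrier (JC Y X)"
      by (auto simp: M_homotopy_rel_def)
    show "refl_on (carrier (JC Y X)) (M_homotopy_rel M p\<^sub>0 p\<^sub>1 Y X)"
    proof (rule refl_onI)
      fix F assume "F \<in> carrier (JC Y X)"
      then obtain a b where ab: "a \<in> JCor Y X" "b \<in> JCor Y X" "F = diff_class Y X a b"
        by (auto simp: carrier_JC)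
      \<comment> \<open>\<open>fst\<close> undoes every slice inclusion, so pulling back along it
        gives a constant homotopy.\<close>
      have "?i p (?pr c) = c" if "c \<in> JCor Y X" "p \<in> topspace (mtop M)" for c p
        by (rule JCor_eqI[OF at(1,3)]) (use that in \<open>simp_all add: i pr\<close>)
      then show "(F, F) \<in> M_homotopy_rel M p\<^sub>0 p\<^sub>1 Y X"
        using ab assms(5,6) by (intro homotopyI[OF pr(1)[OF ab(1)] pr(1)[OF ab(2)]]) simp_all
    qed
    show "sym (M_homotopy_rel M p\<^sub>0 p\<^sub>1 Y X)"
    proof (rule symI)
      fix F G assume "(F, G) \<in> M_homotopy_rel M p\<^sub>0 p\<^sub>1 Y X"
      then obtain a b where ab: "a \<in> JCor ?P X" "b \<in> JCor ?P X"
        "F = diff_class Y X (?i p\<^sub>0 a) (?i p\<^sub>0 b)" "G = diff_class Y X (?i p\<^sub>1 a) (?i p\<^sub>1 b)"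
        using homotopyE by blast
      \<comment> \<open>The slice at \<open>p\<close> of the transformed correspondence is the
        original slice at \<open>\<gamma> p\<close>, so the endpoints trade places.\<close>
      have "?i p (?sw c) = ?i (\<gamma> p) c" if "c \<in> JCor ?P X" "p \<in> {p\<^sub>0, p\<^sub>1}" for c p
        by (rule JCor_eqI[OF at(1,3)]) (use that assms(5,6,8,9) in \<open>auto simp: i sw\<close>)
      then show "(G, F) \<in> M_homotopy_rel M p\<^sub>0 p\<^sub>1 Y X"
        using ab assms(8,9) by (intro homotopyI[OF sw(1)[OF ab(1)] sw(1)[OF ab(2)]]) simp_all
    qed
    show "trans (M_homotopy_rel M p\<^sub>0 p\<^sub>1 Y X)"
    proof (rule transI)
      fix F G K assume "(F, G) \<in> M_homotopy_rel M p\<^sub>0 p\<^sub>1 Y X" "(G, K) \<in> M_homotopy_rel M p\<^sub>0 p\<^sub>1 Y X"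
      then obtain a b c d where ab: "a \<in> JCor ?P X" "b \<in> JCor ?P X" and cd: "c \<in> JCor ?P X" "d \<in> JCor ?P X"
        and F: "F = diff_class Y X (?i p\<^sub>0 a) (?i p\<^sub>0 b)" and K: "K = diff_class Y X (?i p\<^sub>1 c) (?i p\<^sub>1 d)"
        and G: "G = diff_class Y X (?i p\<^sub>1 a) (?i p\<^sub>1 b)" and G': "G = diff_class Y X (?i p\<^sub>0 c) (?i p\<^sub>0 d)"
        using homotopyE by meson
      \<comment> \<open>The difference \<open>?a - ?b\<close> stands for
        \<open>(a - b) + (c - d)\<close> minus the pullback of \<open>G\<close>. With
        \<open>G\<close> written as the slice of \<open>a - b\<close> at \<open>p\<^sub>1\<close>,
        subtraction moves the slice of \<open>b\<close> to the positive part and that of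
        \<open>a\<close> to the negative one.\<close>
      let ?a = "JCor_add ?P X (JCor_add ?P X a c) (?pr (?i p\<^sub>1 b))"
        and ?b = "JCor_add ?P X (JCor_add ?P X b d) (?pr (?i p\<^sub>1 a))"
      note mem = ab cd i(1)[OF assms(5)] i(1)[OF assms(6)] pr(1) add(1) assms(5,6)
      \<comment> \<open>\<open>G\<close> is both the end of \<open>a - b\<close> and the start of
        \<open>c - d\<close>; negative parts are moved across the equation.\<close>
      have G_eq: "corr_val a (y, p\<^sub>1) + corr_val d (y, p\<^sub>0) = corr_val c (y, p\<^sub>0) + corr_val b (y, p\<^sub>1)"
        if "y \<in> ?T" for y
        using G' that unfolding G by (simp add: eq mem i)
      show "(F, K) \<in> M_homotopy_rel M p\<^sub>0 p\<^sub>1 Y X"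
      proof (rule homotopyI[of ?a ?b])
        show "?a \<in> JCor ?P X" "?b \<in> JCor ?P X" by (simp_all add: mem)
        \<comment> \<open>At \<open>p\<^sub>0\<close> the slice of \<open>c - d\<close> cancels
          against the subtracted copy of \<open>G\<close> by \<open>G_eq\<close>.\<close>
        show "F = diff_class Y X (?i p\<^sub>0 ?a) (?i p\<^sub>0 ?b)"
          unfolding F using G_eq by (simp add: eq mem i pr add ac_simps)
        \<comment> \<open>At \<open>p\<^sub>1\<close> the slice of \<open>a - b\<close> meets its
          own negative, since \<open>G\<close> was represented by just this slice.\<close>
        show "K = diff_class Y X (?i p\<^sub>1 ?a) (?i p\<^sub>1 ?b)"
          unfolding K by (simp add: eq mem i pr add ac_simps)
      qed
    qed
  qed
qed

end
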